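(* Let $a,b\in\mathbb{Q}$ with $a\neq0$, let $f(x)=x^8+ax^6+bx^4+ax^2+1\in\mathbb{Q}[x]$ be irreducible over $\mathbb{Q}$, and suppose that $(b+2)^2-4a^2\notin\mathbb{Q}^2$ and $(a^2-4b+8)\big((b+2)^2-4a^2\big)\in\mathbb{Q}^2$. Then $\mathrm{Gal}(f)$ is (1) 8T2 if $b+2-2a\in\mathbb{Q}^2$ or $b+2+2a\in\mathbb{Q}^2$; (2) 8T10 otherwise.
   Context: $\mathbb{Q}^2=\{k^2:k\in\mathbb{Q}\}$. $\mathrm{Gal}(f)$ is the Galois group over $\mathbb{Q}$ of (the splitting field of) $f$, viewed as a transitive permutation group on the eight roots of $f$, i.e. as a transitive subgroup of $S_8$ up to conjugacy. 8Tj denotes the $j$-th conjugacy class of transitive subgroups of $S_8$ in the Butler–McKay (LMFDB) numbering. The classes used here are identified as follows; each consists of exactly the transitive subgroups of $S_8$ that are isomorphic, as abstract groups, to the indicated group: 8T2: $C_4\times C_2$ (order 8); 8T10: the semidirect product $C_2^2\rtimes C_4$ of order 16 in which a generator of $C_4$ acts on $C_2^2=C_2\times C_2$ by swapping the two factors. *)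

theory Defs
  imports "HOL-Algebra.Algebra" "HOL-Algebra.Algebraic_Closure_Type"
    "HOL-Computational_Algebra.Computational_Algebra"
begin

definition rat_squares :: "rat set" where
  "rat_squares = {k\<^sup>2 | k. True}"

definition croots :: "rat poly \<Rightarrow> complex set" where
  "croots f = {z. poly (map_poly of_rat f) z = 0}"

(* The subfield of the complex numbers obtained by adjoining to the rationals all
   complex roots of f; since the complex numbers are algebraically closed, this is
   a splitting field of f over the rationals. *)
definition splitting_field :: "rat poly \<Rightarrow> complex ring" where
  "splitting_field f =
     ring_of_type_algebra\<lparr>carrier := generate_field ring_of_type_algebra (\<rat> \<union> croots f)\<rparr>"

(* As in AutoGroup, automorphisms are extensional functions (undefined outside the
   splitting field), so that each automorphism is represented exactly once. *)
definition galois_group :: "rat poly \<Rightarrow> (complex \<Rightarrow> complex) monoid" where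
  "galois_group f =
     (let K = splitting_field f in
      BijGroup (carrier K)
        \<lparr>carrier := {\<sigma> \<in> ring_iso K K \<inter> Bij (carrier K). \<forall>q \<in> \<rat>. \<sigma> q = q}\<rparr>)"

(* The image of the Galois group in the symmetric group on {1..degree f}, where
   r enumerates the roots: the permutations p with sigma (r i) = r (p i). *)
definition galois_perms :: "rat poly \<Rightarrow> (nat \<Rightarrow> complex) \<Rightarrow> (nat \<Rightarrow> nat) set" where
  "galois_perms f r =
     {p. p permutes {1..degree f} \<and>
         (\<exists>\<sigma> \<in> carrier (galois_group f). \<forall>i \<in> {1..degree f}. \<sigma> (r i) = r (p i))}"

definition transitive_subgroups :: "nat \<Rightarrow> (nat \<Rightarrow> nat) set set" where
  "transitive_subgroups n =
     {H. subgroup H (sym_group n) \<and> (\<forall>i \<in> {1..n}. \<forall>j \<in> {1..n}. \<exists>p \<in> H. p i = j)}"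

(* Different enumerations r of the roots give conjugate subgroups of the symmetric
   group; so if T is a conjugacy class, it is irrelevant which r is taken.  The
   existence of r forces f to have degree f distinct roots. *)
definition galois_type :: "rat poly \<Rightarrow> (nat \<Rightarrow> nat) set set \<Rightarrow> bool" where
  "galois_type f T \<longleftrightarrow>
     (\<exists>r. bij_betw r {1..degree f} (croots f) \<and> galois_perms f r \<in> T)"

definition semidirect_product ::
  "('a, 'm) monoid_scheme \<Rightarrow> ('b, 'n) monoid_scheme \<Rightarrow> ('b \<Rightarrow> 'a \<Rightarrow> 'a) \<Rightarrow> ('a \<times> 'b) monoid" where
  "semidirect_product N H \<phi> =
     \<lparr>carrier = carrier N \<times> carrier H,
      monoid.mult = (\<lambda>(n, h) (n', h'). (n \<otimes>\<^bsub>N\<^esub> \<phi> h n', h \<otimes>\<^bsub>H\<^esub> h')),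
      one = (\<one>\<^bsub>N\<^esub>, \<one>\<^bsub>H\<^esub>)\<rparr>"

(* The generator 1 of the cyclic group of order 4 acts by interchanging the factors. *)
definition C2sq_C4 :: "((int \<times> int) \<times> int) monoid" where
  "C2sq_C4 =
     semidirect_product (integer_mod_group 2 \<times>\<times> integer_mod_group 2) (integer_mod_group 4)
       (\<lambda>h. prod.swap ^^ nat h)"

(* Each of these sets is a single conjugacy class of subgroups of the symmetric
   group on eight points, in the Butler-McKay (LMFDB) numbering. *)
definition class_8T2 :: "(nat \<Rightarrow> nat) set set" where
  "class_8T2 = {H \<in> transitive_subgroups 8.
     (sym_group 8)\<lparr>carrier := H\<rparr> \<cong> integer_mod_group 4 \<times>\<times> integer_mod_group 2}"

definition class_8T10 :: "(nat \<Rightarrow> nat) set set" where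
  "class_8T10 = {H \<in> transitive_subgroups 8. (sym_group 8)\<lparr>carrier := H\<rparr> \<cong> C2sq_C4}"

end

theory Submission
  imports Defs
begin

text \<open>Put t = x^2 + 1/x^2. Dividing f by x^4 turns f(x) = 0 into t^2 + a t + b - 2 = 0, whose two zeros
  are distinct; let x and z be roots of f that give these two values. Then the roots are \<pm>x, \<pm>z, \<pm>1/x and \<pm>1/z,
  and (x^2 - 1/x^2)(z^2 - 1/z^2) is a rational multiple of the difference of the two zeros, because the
  product of the squares of these two numbers is a rational square by hypothesis.

  An automorphism has to respect this relation. For \<delta> = 1 or -1 arrange the roots up to sign in
  the cycle x, z, \<delta>/x, \<delta>/z. The relation says that an automorphism rotates this cycle, up to one
  sign at the positions of x and \<delta>/x and another one at those of z and \<delta>/z. The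
  signed rotations form the semidirect product of order 16, so the Galois group is contained in
  it (lemma \<open>embedding_acts\<close>).

  The element s = (x + \<delta>/x)(z + \<delta>/z) has the rational square b + 2 - 2 \<delta> a and generates the splitting
  field over the field generated by x, which has degree 8. An automorphism multiplies s by the
  product of its two signs. If s is rational for some \<delta>, the two signs coincide, and as x can be sent
  to each of the eight roots, the Galois group consists of all signed rotations with equal signs,
  a group isomorphic to the product of cyclic groups of orders 4 and 2. If s lies outside
  the field generated by x, then x and s can be mapped independently, and all 16 signed rotations
  occur. The remaining possibility, that s is an irrational element of the field generated by x
  for both choices of \<delta>, is excluded by lemma \<open>rational_s\<close>: if x alone generates the splitting
  field, then the automorphisms sending x to -x and x to z both fix s for a suitable \<delta>, and they
  generate a group that is transitive on the roots.\<close>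

section \<open>Embeddings of subfields of the complex numbers\<close>

text \<open>All fields occurring here are subfields of the complex numbers, so they are handled as sets of
  complex numbers closed under the field operations; an embedding is any function that is
  multiplicative and additive on such a set and fixes the rationals. Automorphisms of the
  splitting field are embeddings of it, and only the latter need to be constructed.\<close>

abbreviation ev :: "rat poly \<Rightarrow> complex \<Rightarrow> complex" where
  "ev p x \<equiv> poly (map_poly of_rat p) x"

lemma ev_pCons [simp]: "ev (pCons c p) x = of_rat c + x * ev p x"
  by (simp add: map_poly_pCons)

lemma ev_add [simp]: "ev (p + q) x = ev p x + ev q x"
  by (induction p q rule: poly_induct2) (simp_all add: of_rat_add algebra_simps)

lemma ev_smult [simp]: "ev (smult c p) x = of_rat c * ev p x"
  by (induction p) (simp_all add: of_rat_mult algebra_simps)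

lemma ev_mult [simp]: "ev (p * q) x = ev p x * ev q x"
  by (induction p) (simp_all add: algebra_simps)

lemma ev_diff [simp]: "ev (p - q) x = ev p x - ev q x"
proof -
  have "ev (p + smult (-1) q) x = ev p x - ev q x"
    by (simp only: ev_add ev_smult) simp
  then show ?thesis by simp
qed

definition complex_subfield :: "complex set \<Rightarrow> bool" where
  "complex_subfield E \<longleftrightarrow> \<rat> \<subseteq> E \<and> (\<forall>x\<in>E. \<forall>y\<in>E. x + y \<in> E \<and> x * y \<in> E) \<and> (\<forall>x\<in>E. inverse x \<in> E)"

definition embedding :: "complex set \<Rightarrow> (complex \<Rightarrow> complex) \<Rightarrow> bool" where
  "embedding E \<tau> \<longleftrightarrow>
     (\<forall>x\<in>E. \<forall>y\<in>E. \<tau> (x + y) = \<tau> x + \<tau> y \<and> \<tau> (x * y) = \<tau> x * \<tau> y) \<and> (\<forall>q\<in>\<rat>. \<tau> q = q)"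

context
  fixes E :: "complex set"
  assumes E: "complex_subfield E"
begin

lemma subfield_Rats: "q \<in> \<rat> \<Longrightarrow> q \<in> E"
  and subfield_add: "x \<in> E \<Longrightarrow> y \<in> E \<Longrightarrow> x + y \<in> E"
  and subfield_mult: "x \<in> E \<Longrightarrow> y \<in> E \<Longrightarrow> x * y \<in> E"
  and subfield_inverse: "x \<in> E \<Longrightarrow> inverse x \<in> E"
  using E by (auto simp: complex_subfield_def)

lemma subfield_uminus: "x \<in> E \<Longrightarrow> - x \<in> E"
  using subfield_mult[of "-1" x] subfield_Rats[of "-1"] by simp

lemma subfield_diff: "x \<in> E \<Longrightarrow> y \<in> E \<Longrightarrow> x - y \<in> E"
  using subfield_add[of x "-y"] subfield_uminus[of y] by simp

lemma subfield_divide: "x \<in> E \<Longrightarrow> y \<in> E \<Longrightarrow> x / y \<in> E"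
  using subfield_mult[of x "inverse y"] subfield_inverse[of y] by (simp add: divide_inverse)

lemma subfield_power: "x \<in> E \<Longrightarrow> x ^ n \<in> E"
  by (induction n) (auto intro: subfield_mult subfield_Rats)

lemma subfield_ev: "x \<in> E \<Longrightarrow> ev p x \<in> E"
  by (induction p) (simp_all add: subfield_add subfield_mult subfield_Rats)

lemmas subfield_intros = subfield_Rats subfield_add subfield_mult subfield_inverse
  subfield_uminus subfield_diff subfield_divide subfield_power subfield_ev

context
  fixes \<tau> :: "complex \<Rightarrow> complex"
  assumes \<tau>: "embedding E \<tau>"
begin

lemma embedding_Rats: "q \<in> \<rat> \<Longrightarrow> \<tau> q = q"
  and embedding_add: "x \<in> E \<Longrightarrow> y \<in> E \<Longrightarrow> \<tau> (x + y) = \<tau> x + \<tau> y"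
  and embedding_mult: "x \<in> E \<Longrightarrow> y \<in> E \<Longrightarrow> \<tau> (x * y) = \<tau> x * \<tau> y"
  using \<tau> by (auto simp: embedding_def)

lemma embedding_0: "\<tau> 0 = 0" and embedding_1: "\<tau> 1 = 1"
  using embedding_Rats by auto

lemma embedding_uminus: "x \<in> E \<Longrightarrow> \<tau> (- x) = - \<tau> x"
  using embedding_mult[of "-1" x] subfield_Rats[of "-1"] embedding_Rats[of "-1"] by simp

lemma embedding_diff: "x \<in> E \<Longrightarrow> y \<in> E \<Longrightarrow> \<tau> (x - y) = \<tau> x - \<tau> y"
  using embedding_add[of x "-y"] subfield_uminus[of y] embedding_uminus[of y] by simp

lemma embedding_inverse: "x \<in> E \<Longrightarrow> \<tau> (inverse x) = inverse (\<tau> x)"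
proof (cases "x = 0")
  case False
  assume x: "x \<in> E"
  have "\<tau> x * \<tau> (inverse x) = 1"
    using embedding_mult[OF x subfield_inverse[OF x]] False embedding_1 by simp
  then show ?thesis
    by (metis inverse_unique)
qed (use embedding_0 in simp)

lemma embedding_divide: "x \<in> E \<Longrightarrow> y \<in> E \<Longrightarrow> \<tau> (x / y) = \<tau> x / \<tau> y"
  using embedding_mult[of x "inverse y"] subfield_inverse[of y] embedding_inverse[of y]
  by (simp add: divide_inverse)

lemma embedding_power: "x \<in> E \<Longrightarrow> \<tau> (x ^ n) = \<tau> x ^ n"
  by (induction n) (simp_all add: embedding_1 embedding_mult subfield_power)

lemma embedding_ev: "x \<in> E \<Longrightarrow> \<tau> (ev p x) = ev p (\<tau> x)"
  by (induction p) (simp_all add: embedding_0 embedding_add embedding_mult embedding_Rats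
      subfield_intros)

lemma embedding_inj: "inj_on \<tau> E"
proof (rule inj_onI)
  fix x y assume xy: "x \<in> E" "y \<in> E" "\<tau> x = \<tau> y"
  show "x = y"
  proof (rule ccontr)
    assume "x \<noteq> y"
    have "\<tau> (x - y) * \<tau> (inverse (x - y)) = 1"
      using embedding_mult[of "x - y" "inverse (x - y)"] xy \<open>x \<noteq> y\<close> embedding_1
      by (simp add: subfield_intros)
    then show False using xy embedding_diff by simp
  qed
qed

end
end

lemma embedding_mono: "embedding E \<tau> \<Longrightarrow> E' \<subseteq> E \<Longrightarrow> embedding E' \<tau>"
  unfolding embedding_def by blast

lemma irreducible_bezout:
  fixes f p :: "rat poly"
  assumes "Factorial_Ring.irreducible f" "\<not> f dvd p"
  obtains u v where "u * f + v * p = 1"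
proof -
  have "coprime f p"
    using assms by (metis prime_elem_imp_coprime irreducible_imp_prime_elem_gcd)
  then have "fst (bezout_coefficients f p) * f + snd (bezout_coefficients f p) * p = 1"
    by (simp add: bezout_coefficients_fst_snd)
  then show ?thesis by (rule that)
qed

text \<open>If f did not divide p, a Bezout identity u f + v p = 1 evaluated at the common root x would read
  0 = 1. So an irreducible f is, up to a unit, the minimal polynomial of each of its roots.\<close>

lemma irreducible_root_dvd:
  assumes "Factorial_Ring.irreducible f" "ev f x = 0"
  shows "ev p x = 0 \<longleftrightarrow> f dvd p"
proof
  show "ev p x = 0" if "f dvd p"
    using that assms by (auto elim!: dvdE)
  show "f dvd p" if "ev p x = 0"
  proof (rule ccontr)
    assume "\<not> f dvd p"
    then obtain u v where "u * f + v * p = 1"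
      using irreducible_bezout assms by blast
    then have "ev (u * f + v * p) x = 1" by simp
    then show False using that assms by simp
  qed
qed

definition adjoin :: "complex \<Rightarrow> complex set" where
  "adjoin x = range (\<lambda>p. ev p x)"

lemma adjoin_ev: "ev p x \<in> adjoin x" by (simp add: adjoin_def)

lemma adjoin_self: "x \<in> adjoin x"
  using adjoin_ev[of "[:0, 1:]" x] by simp

text \<open>Polynomial expressions in an algebraic number already form a field: the cofactor of p in the
  Bezout identity with f supplies the inverse of p evaluated at x.\<close>

lemma complex_subfield_adjoin:
  assumes "Factorial_Ring.irreducible f" "ev f x = 0"
  shows "complex_subfield (adjoin x)"
  unfolding complex_subfield_def
proof (intro conjI ballI subsetI)
  fix q :: complex assume "q \<in> \<rat>"
  then obtain c where "q = of_rat c" by (auto elim: Rats_cases)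
  then have "q = ev [:c:] x" by simp
  then show "q \<in> adjoin x" by (simp only: adjoin_ev)
next
  fix y y' assume "y \<in> adjoin x" "y' \<in> adjoin x"
  then obtain p q where "y = ev p x" "y' = ev q x" by (auto simp: adjoin_def)
  then have "y + y' = ev (p + q) x" "y * y' = ev (p * q) x" by simp_all
  then show "y + y' \<in> adjoin x" "y * y' \<in> adjoin x" by (simp_all only: adjoin_ev)
next
  fix y assume "y \<in> adjoin x"
  then obtain p where p: "y = ev p x" by (auto simp: adjoin_def)
  show "inverse y \<in> adjoin x"
  proof (cases "f dvd p")
    case True
    then show ?thesis using p adjoin_ev[of 0 x] irreducible_root_dvd[OF assms, of p] by simp
  next
    case False
    then obtain u v where "u * f + v * p = 1"
      using irreducible_bezout assms by blast
    then have "ev (u * f + v * p) x = 1" by simp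
    then have "inverse y = ev v x"
      using assms p by (simp add: inverse_unique mult.commute)
    then show ?thesis by (simp only: adjoin_ev)
  qed
qed

text \<open>Two rational polynomials agree at the root x exactly if f divides their difference, hence exactly
  if they agree at the root r. So replacing x by r in polynomial expressions is well defined.\<close>

lemma embedding_adjoin:
  assumes "Factorial_Ring.irreducible f" "ev f x = 0" "ev f r = 0"
  obtains \<sigma> where "embedding (adjoin x) \<sigma>" "\<And>p. \<sigma> (ev p x) = ev p r"
proof -
  define \<sigma> where "\<sigma> y = ev (SOME p. ev p x = y) r" for y
  have \<sigma>: "\<sigma> (ev p x) = ev p r" for p
  proof -
    define q where "q = (SOME q. ev q x = ev p x)"
    have "ev q x = ev p x" unfolding q_def by (rule someI[of _ p]) simp
    then have "f dvd q - p" using irreducible_root_dvd[OF assms(1,2), of "q - p"] by simp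
    then have "ev (q - p) r = 0" using irreducible_root_dvd[OF assms(1,3)] by blast
    then show ?thesis by (simp add: \<sigma>_def flip: q_def)
  qed
  have "embedding (adjoin x) \<sigma>"
    unfolding embedding_def
  proof (intro conjI ballI)
    fix y y' assume "y \<in> adjoin x" "y' \<in> adjoin x"
    then obtain p q where y: "y = ev p x" "y' = ev q x" by (auto simp: adjoin_def)
    then show "\<sigma> (y + y') = \<sigma> y + \<sigma> y'" "\<sigma> (y * y') = \<sigma> y * \<sigma> y'"
      using \<sigma>[of "p + q"] \<sigma>[of "p * q"] by (simp_all add: \<sigma>)
  next
    fix q :: complex assume "q \<in> \<rat>"
    then obtain c where "q = of_rat c" by (auto elim: Rats_cases)
    then show "\<sigma> q = q" using \<sigma>[of "[:c:]"] by simp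
  qed
  then show ?thesis using \<sigma> by (rule that)
qed

definition adjoin_root :: "complex set \<Rightarrow> complex \<Rightarrow> complex set" where
  "adjoin_root E s = {u + v * s | u v. u \<in> E \<and> v \<in> E}"

lemma adjoin_rootI: "u \<in> E \<Longrightarrow> v \<in> E \<Longrightarrow> u + v * s \<in> adjoin_root E s"
  by (auto simp: adjoin_root_def)

lemma
  assumes "complex_subfield E"
  shows adjoin_root_base: "u \<in> E \<Longrightarrow> u \<in> adjoin_root E s"
    and adjoin_root_self: "s \<in> adjoin_root E s"
  using adjoin_rootI[of u E 0 s] adjoin_rootI[of 0 E 1 s]
  by (simp_all add: subfield_Rats[OF assms])

lemma adjoin_root_trivial:
  assumes "complex_subfield E" "s \<in> E"
  shows "adjoin_root E s = E"
  using adjoin_root_base[OF assms(1)] assms subfield_intros[OF assms(1)]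
  by (auto simp: adjoin_root_def)

text \<open>If s lies outside E, the norm (u + v s)(u - v s) is a nonzero element of E for (u, v) \<noteq> (0, 0), so
  the usual conjugate formula gives inverses. Allowing s in E as well, where nothing is
  added, lets the splitting field of the octic be treated uniformly.\<close>

lemma complex_subfield_adjoin_root:
  assumes E: "complex_subfield E" and s2: "s\<^sup>2 \<in> E"
  shows "complex_subfield (adjoin_root E s)"
proof (cases "s \<in> E")
  case True
  then show ?thesis using adjoin_root_trivial E by simp
next
  case False
  note E_intros = subfield_intros[OF E]
  show ?thesis
    unfolding complex_subfield_def
  proof (intro conjI ballI subsetI)
    fix q :: complex assume "q \<in> \<rat>"
    then show "q \<in> adjoin_root E s"
      using adjoin_root_base[OF E] E_intros by blast
  next
    fix y y' assume "y \<in> adjoin_root E s" "y' \<in> adjoin_root E s"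
    then obtain u v u' v' where uv: "u \<in> E" "v \<in> E" "u' \<in> E" "v' \<in> E"
      and y: "y = u + v * s" "y' = u' + v' * s" by (auto simp: adjoin_root_def)
    have "y + y' = (u + u') + (v + v') * s" by (simp add: y algebra_simps)
    then show "y + y' \<in> adjoin_root E s"
      using adjoin_rootI[of "u + u'" E "v + v'" s] uv E_intros by simp
    have "y * y' = (u * u' + v * v' * s\<^sup>2) + (u * v' + v * u') * s"
      by (simp add: y algebra_simps power2_eq_square)
    moreover have "u * u' + v * v' * s\<^sup>2 \<in> E" "u * v' + v * u' \<in> E"
      using uv s2 E_intros by auto
    ultimately show "y * y' \<in> adjoin_root E s"
      by (simp only: adjoin_rootI)
  next
    fix y assume "y \<in> adjoin_root E s"
    then obtain u v where uv: "u \<in> E" "v \<in> E" and y: "y = u + v * s"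
      by (auto simp: adjoin_root_def)
    show "inverse y \<in> adjoin_root E s"
    proof (cases "v = 0")
      case True
      then show ?thesis using uv y adjoin_root_base[OF E] E_intros(4) by simp
    next
      case v: False
      have "u + v * s \<noteq> 0"
      proof
        assume "u + v * s = 0"
        then have "s = - u / v" using v by (simp add: field_simps eq_neg_iff_add_eq_0)
        then show False using False uv E_intros by metis
      qed
      moreover have "u - v * s \<noteq> 0"
      proof
        assume "u - v * s = 0"
        then have "s = u / v" using v by (simp add: field_simps)
        then show False using False uv E_intros by metis
      qed
      ultimately have "(u + v * s) * (u - v * s) \<noteq> 0" by simp
      moreover define N where "N = u\<^sup>2 - v\<^sup>2 * s\<^sup>2"
      moreover have N: "(u + v * s) * (u - v * s) = N"
        by (simp add: N_def algebra_simps power2_eq_square)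
      ultimately have "y * ((u - v * s) / N) = 1"
        by (simp add: y)
      then have "inverse y = u / N + (- v / N) * s"
        by (simp add: inverse_unique diff_divide_distrib)
      moreover have "N \<in> E" unfolding N_def using uv s2 by (simp add: E_intros)
      ultimately show ?thesis
        using adjoin_rootI[of "u / N" E "- v / N" s] uv E_intros by simp
    qed
  qed
qed

text \<open>A square root s outside the base field can be sent to either square root of the image of its
  square, because writing an element as u + v s with u and v in the base field is unambiguous.\<close>

lemma embedding_adjoin_root:
  assumes E: "complex_subfield E" and \<sigma>: "embedding E \<sigma>"
    and s: "s \<notin> E" "s\<^sup>2 \<in> E" and t: "t\<^sup>2 = \<sigma> (s\<^sup>2)"
  obtains \<tau> where "embedding (adjoin_root E s) \<tau>" "\<And>u. u \<in> E \<Longrightarrow> \<tau> u = \<sigma> u" "\<tau> s = t"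
proof -
  note E_intros = subfield_intros[OF E]
  have unique: "u = u' \<and> v = v'"
    if "u + v * s = u' + v' * s" "u \<in> E" "v \<in> E" "u' \<in> E" "v' \<in> E" for u v u' v'
  proof (rule ccontr)
    assume "\<not> ?thesis"
    then have "v \<noteq> v'" using that by auto
    then have "s = (u' - u) / (v - v')" using that by (simp add: field_simps)
    then show False using that E_intros s(1) by metis
  qed
  define \<tau> where "\<tau> y = (THE w. \<exists>u\<in>E. \<exists>v\<in>E. y = u + v * s \<and> w = \<sigma> u + \<sigma> v * t)" for y
  have \<tau>: "\<tau> (u + v * s) = \<sigma> u + \<sigma> v * t" if "u \<in> E" "v \<in> E" for u v
    unfolding \<tau>_def using unique that by (intro the_equality) blast+
  note hom = embedding_add[OF E \<sigma>] embedding_mult[OF E \<sigma>]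
  show ?thesis
  proof (rule that)
    show base: "\<tau> u = \<sigma> u" if "u \<in> E" for u
      using \<tau>[of u 0] that E_intros(1) embedding_0[OF E \<sigma>] by simp
    show "\<tau> s = t"
      using \<tau>[of 0 1] E_intros(1) embedding_0[OF E \<sigma>] embedding_1[OF E \<sigma>] by simp
    show "embedding (adjoin_root E s) \<tau>"
      unfolding embedding_def
    proof (intro conjI ballI)
      fix q :: complex assume "q \<in> \<rat>"
      then show "\<tau> q = q" using base embedding_Rats[OF E \<sigma>] E_intros(1) by simp
    next
      fix y y' assume "y \<in> adjoin_root E s" "y' \<in> adjoin_root E s"
      then obtain u v u' v' where uv: "u \<in> E" "v \<in> E" "u' \<in> E" "v' \<in> E"
        and y: "y = u + v * s" "y' = u' + v' * s" by (auto simp: adjoin_root_def)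
      have y': "\<tau> y = \<sigma> u + \<sigma> v * t" "\<tau> y' = \<sigma> u' + \<sigma> v' * t"
        using uv by (simp_all add: y \<tau>)
      have "y + y' = (u + u') + (v + v') * s" by (simp add: y algebra_simps)
      then have "\<tau> (y + y') = \<sigma> (u + u') + \<sigma> (v + v') * t" using uv E_intros by (metis \<tau>)
      then show "\<tau> (y + y') = \<tau> y + \<tau> y'"
        using uv by (simp add: y' hom algebra_simps)
      have "y * y' = (u * u' + v * v' * s\<^sup>2) + (u * v' + v * u') * s"
        by (simp add: y algebra_simps power2_eq_square)
      moreover have "u * u' + v * v' * s\<^sup>2 \<in> E" "u * v' + v * u' \<in> E"
        using uv s E_intros by auto
      ultimately have "\<tau> (y * y') = \<sigma> (u * u' + v * v' * s\<^sup>2) + \<sigma> (u * v' + v * u') * t"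
        by (metis \<tau>)
      also have "\<dots> = (\<sigma> u * \<sigma> u' + \<sigma> v * \<sigma> v' * t\<^sup>2) + (\<sigma> u * \<sigma> v' + \<sigma> v * \<sigma> u') * t"
        using uv s E_intros by (simp add: hom t)
      also have "\<dots> = \<tau> y * \<tau> y'"
        by (simp add: y' algebra_simps power2_eq_square)
      finally show "\<tau> (y * y') = \<tau> y * \<tau> y'" .
    qed
  qed
qed

section \<open>Automorphisms of a splitting field\<close>

lemma croots_ev: "croots f = {z. ev f z = 0}" by (simp add: croots_def)

lemma carrier_splitting_field:
  "carrier (splitting_field f) = generate_field ring_of_type_algebra (\<rat> \<union> croots f)"
  by (simp add: splitting_field_def)

lemma inverse_ring_of_type_algebra:
  fixes y :: complex
  assumes "y \<noteq> 0"
  shows "inv\<^bsub>ring_of_type_algebra\<^esub> y = inverse y"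
proof -
  interpret field "ring_of_type_algebra :: complex ring" by (rule field_from_type_algebra)
  show ?thesis
    by (rule comm_inv_char) (use assms in \<open>auto simp: ring_of_type_algebra_def\<close>)
qed

lemma uminus_ring_of_type_algebra: "\<ominus>\<^bsub>ring_of_type_algebra\<^esub> y = - (y :: complex)"
proof -
  interpret field "ring_of_type_algebra :: complex ring" by (rule field_from_type_algebra)
  show ?thesis
    by (rule sym, rule sum_zero_eq_neg) (auto simp: ring_of_type_algebra_def)
qed

lemma splitting_field_subset:
  assumes E: "complex_subfield E" and "croots f \<subseteq> E"
  shows "carrier (splitting_field f) \<subseteq> E"
proof
  fix y assume "y \<in> carrier (splitting_field f)"
  then show "y \<in> E"
    unfolding carrier_splitting_field
  proof (induction rule: generate_field.induct)
    case (m_inv h)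
    then show ?case using subfield_intros[OF E]
      by (subst inverse_ring_of_type_algebra) (auto simp: ring_of_type_algebra_def)
  next
    case (a_inv h)
    then show ?case using subfield_intros[OF E] by (simp add: uminus_ring_of_type_algebra)
  qed (use assms(2) subfield_intros[OF E] in \<open>auto simp: ring_of_type_algebra_def\<close>)
qed

lemma complex_subfield_splitting_field: "complex_subfield (carrier (splitting_field f))"
  unfolding complex_subfield_def carrier_splitting_field
proof (intro conjI ballI)
  let ?K = "generate_field ring_of_type_algebra (\<rat> \<union> croots f)"
  show "\<rat> \<subseteq> ?K" by (auto intro: generate_field.incl)
  fix x assume x: "x \<in> ?K"
  show "inverse x \<in> ?K"
  proof (cases "x = 0")
    case True
    then show ?thesis by (auto intro: generate_field.incl)
  next
    case False
    then show ?thesis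
      using generate_field.m_inv[OF x] inverse_ring_of_type_algebra[of x]
      by (auto simp: ring_of_type_algebra_def)
  qed
  fix y assume y: "y \<in> ?K"
  show "x + y \<in> ?K" "x * y \<in> ?K"
    using generate_field.eng_add[OF x y] generate_field.eng_mult[OF x y]
    by (auto simp: ring_of_type_algebra_def)
qed

lemma croots_subset_splitting_field: "croots f \<subseteq> carrier (splitting_field f)"
  unfolding carrier_splitting_field by (auto intro: generate_field.incl)

lemma finite_croots: "f \<noteq> 0 \<Longrightarrow> finite (croots f)"
  unfolding croots_def by (rule poly_roots_finite) (simp add: map_poly_eq_0_iff)

lemma embedding_permutes_roots:
  assumes "f \<noteq> 0" "complex_subfield E" "croots f \<subseteq> E" "embedding E \<tau>"
  shows "bij_betw \<tau> (croots f) (croots f)"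
proof -
  have "\<tau> ` croots f \<subseteq> croots f"
  proof clarify
    fix z assume z: "z \<in> croots f"
    then have "\<tau> (ev f z) = ev f (\<tau> z)"
      using assms(3) by (intro embedding_ev[OF assms(2,4)]) blast
    then show "\<tau> z \<in> croots f"
      using z embedding_0[OF assms(2,4)] by (simp add: croots_ev)
  qed
  moreover have "inj_on \<tau> (croots f)"
    using embedding_inj[OF assms(2,4)] assms(3) by (rule inj_on_subset)
  ultimately show ?thesis
    using finite_croots[OF assms(1)] by (simp add: bij_betw_def endo_inj_surj)
qed

lemma galois_group_carrier:
  "carrier (galois_group f) =
    {\<sigma> \<in> ring_iso (splitting_field f) (splitting_field f) \<inter> Bij (carrier (splitting_field f)).
      \<forall>q\<in>\<rat>. \<sigma> q = q}"
  by (simp add: galois_group_def Let_def)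

lemma splitting_field_ops:
  "x \<oplus>\<^bsub>splitting_field f\<^esub> y = x + y" "x \<otimes>\<^bsub>splitting_field f\<^esub> y = x * y"
  "\<one>\<^bsub>splitting_field f\<^esub> = 1"
  by (simp_all add: splitting_field_def ring_of_type_algebra_def)

lemma embedding_galois_group:
  assumes "\<sigma> \<in> carrier (galois_group f)"
  shows "embedding (carrier (splitting_field f)) \<sigma>"
  using assms unfolding galois_group_carrier embedding_def
  by (auto simp: ring_iso_def ring_hom_def splitting_field_ops)

text \<open>An embedding of the splitting field permutes the finitely many roots, hence maps the field
  generated by them onto itself; its restriction is therefore an automorphism.\<close>

lemma galois_group_embedding:
  assumes "f \<noteq> 0" and \<tau>: "embedding (carrier (splitting_field f)) \<tau>"
  shows "restrict \<tau> (carrier (splitting_field f)) \<in> carrier (galois_group f)"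
proof -
  define K where "K = carrier (splitting_field f)"
  note K = complex_subfield_splitting_field[of f, folded K_def]
  note \<tau> = \<tau>[folded K_def]
  note K_intros = subfield_intros[OF K]
  note roots = croots_subset_splitting_field[of f, folded K_def]
  note perm = embedding_permutes_roots[OF assms(1) K roots \<tau>]
  have "complex_subfield {y \<in> K. \<tau> y \<in> K}"
    unfolding complex_subfield_def
    using K_intros by (auto simp: embedding_Rats[OF K \<tau>] embedding_add[OF K \<tau>]
        embedding_mult[OF K \<tau>] embedding_inverse[OF K \<tau>])
  moreover have "croots f \<subseteq> {y \<in> K. \<tau> y \<in> K}"
    using roots perm by (auto simp: bij_betw_def)
  ultimately have "K \<subseteq> {y \<in> K. \<tau> y \<in> K}"
    unfolding K_def by (rule splitting_field_subset)
  moreover have "K \<subseteq> \<tau> ` K"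
    unfolding K_def
  proof (rule splitting_field_subset, fold K_def)
    show "croots f \<subseteq> \<tau> ` K"
      using image_mono[OF roots, of \<tau>] perm by (simp add: bij_betw_def)
    show "complex_subfield (\<tau> ` K)"
      unfolding complex_subfield_def
    proof (intro conjI ballI subsetI)
      fix q :: complex assume "q \<in> \<rat>"
      then show "q \<in> \<tau> ` K" using K_intros(1) embedding_Rats[OF K \<tau>] by force
    next
      fix y y' assume "y \<in> \<tau> ` K" "y' \<in> \<tau> ` K"
      then obtain u u' where u: "u \<in> K" "u' \<in> K" and y: "y = \<tau> u" "y' = \<tau> u'" by blast
      have "y + y' = \<tau> (u + u')" "y * y' = \<tau> (u * u')"
        using u by (simp_all add: y embedding_add[OF K \<tau>] embedding_mult[OF K \<tau>])
      then show "y + y' \<in> \<tau> ` K" "y * y' \<in> \<tau> ` K"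
        using u K_intros(2,3) by auto
    next
      fix y assume "y \<in> \<tau> ` K"
      then obtain u where u: "u \<in> K" and y: "y = \<tau> u" by blast
      have "inverse y = \<tau> (inverse u)" using u by (simp add: y embedding_inverse[OF K \<tau>])
      then show "inverse y \<in> \<tau> ` K" using u K_intros(4) by auto
    qed
  qed
  ultimately have "\<tau> ` K = K" by blast
  with embedding_inj[OF K \<tau>] have "bij_betw \<tau> K K" by (rule bij_betw_imageI)
  moreover have "bij_betw (restrict \<tau> K) K K \<longleftrightarrow> bij_betw \<tau> K K"
    by (rule bij_betw_cong) simp
  ultimately have bij': "bij_betw (restrict \<tau> K) K K" by blast
  have "restrict \<tau> K \<in> ring_hom (splitting_field f) (splitting_field f)"
  proof (rule ring_hom_memI, unfold splitting_field_ops, fold K_def)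
    show "restrict \<tau> K 1 = 1"
      using K_intros(1) embedding_1[OF K \<tau>] by simp
    show "restrict \<tau> K x \<in> K" if "x \<in> K" for x
      using that bij' by (auto simp: bij_betw_def)
    show "restrict \<tau> K (x + y) = restrict \<tau> K x + restrict \<tau> K y"
      "restrict \<tau> K (x * y) = restrict \<tau> K x * restrict \<tau> K y" if "x \<in> K" "y \<in> K" for x y
      using that K_intros(2,3) by (simp_all add: embedding_add[OF K \<tau>] embedding_mult[OF K \<tau>])
  qed
  moreover have "restrict \<tau> K q = q" if "q \<in> \<rat>" for q
    using that K_intros(1) embedding_Rats[OF K \<tau>] by simp
  ultimately show ?thesis
    unfolding galois_group_carrier ring_iso_def Bij_def K_def[symmetric]
    using bij' by blast
qed

lemma galois_perms_embedding:
  assumes "f \<noteq> 0" and r: "bij_betw r {1..degree f} (croots f)"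
  shows "galois_perms f r = {p. p permutes {1..degree f} \<and>
    (\<exists>\<tau>. embedding (carrier (splitting_field f)) \<tau> \<and> (\<forall>i\<in>{1..degree f}. \<tau> (r i) = r (p i)))}"
proof -
  have "r i \<in> carrier (splitting_field f)" if "i \<in> {1..degree f}" for i
    using r that croots_subset_splitting_field[of f] by (auto simp: bij_betw_def)
  then have "\<exists>\<sigma>\<in>carrier (galois_group f). \<forall>i\<in>{1..degree f}. \<sigma> (r i) = r (p i)"
    if "embedding (carrier (splitting_field f)) \<tau>" "\<forall>i\<in>{1..degree f}. \<tau> (r i) = r (p i)" for p \<tau>
    using that by (intro bexI[OF _ galois_group_embedding[OF assms(1) that(1)]]) simp
  then show ?thesis
    unfolding galois_perms_def using embedding_galois_group[of _ f] by blast
qed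

section \<open>The group of order 16 and its action on eight points\<close>

lemma group_semidirect_product:
  assumes "group N" "group H"
    and hom: "\<And>h. h \<in> carrier H \<Longrightarrow> \<phi> h \<in> hom N N"
    and one: "\<And>n. n \<in> carrier N \<Longrightarrow> \<phi> \<one>\<^bsub>H\<^esub> n = n"
    and mult: "\<And>h h' n. h \<in> carrier H \<Longrightarrow> h' \<in> carrier H \<Longrightarrow> n \<in> carrier N \<Longrightarrow>
      \<phi> (h \<otimes>\<^bsub>H\<^esub> h') n = \<phi> h (\<phi> h' n)"
  shows "group (semidirect_product N H \<phi>)"
proof -
  interpret N: group N by fact
  interpret H: group H by fact
  have closed: "\<phi> h n \<in> carrier N" if "h \<in> carrier H" "n \<in> carrier N" for h n
    using hom_in_carrier[OF hom[OF that(1)] that(2)] .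
  have \<phi>_mult: "\<phi> h (n \<otimes>\<^bsub>N\<^esub> n') = \<phi> h n \<otimes>\<^bsub>N\<^esub> \<phi> h n'"
    if "h \<in> carrier H" "n \<in> carrier N" "n' \<in> carrier N" for h n n'
    using hom_mult[OF hom[OF that(1)] that(2,3)] .
  have \<phi>_one: "\<phi> h \<one>\<^bsub>N\<^esub> = \<one>\<^bsub>N\<^esub>" if "h \<in> carrier H" for h
    using hom_one[OF hom[OF that]] assms(1) by blast
  show ?thesis
  proof (rule groupI)
    fix x assume "x \<in> carrier (semidirect_product N H \<phi>)"
    then obtain n h where x: "x = (n, h)" "n \<in> carrier N" "h \<in> carrier H"
      by (auto simp: semidirect_product_def)
    \<comment> \<open>The inverse of (n, h) in a semidirect product.\<close>
    let ?y = "(\<phi> (inv\<^bsub>H\<^esub> h) (inv\<^bsub>N\<^esub> n), inv\<^bsub>H\<^esub> h)"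
    have "\<phi> (inv\<^bsub>H\<^esub> h) (inv\<^bsub>N\<^esub> n) \<otimes>\<^bsub>N\<^esub> \<phi> (inv\<^bsub>H\<^esub> h) n = \<one>\<^bsub>N\<^esub>"
      using x by (simp add: \<phi>_one flip: \<phi>_mult)
    then show "\<exists>y\<in>carrier (semidirect_product N H \<phi>).
        y \<otimes>\<^bsub>semidirect_product N H \<phi>\<^esub> x = \<one>\<^bsub>semidirect_product N H \<phi>\<^esub>"
      using x by (intro bexI[of _ ?y]) (auto simp: semidirect_product_def closed)
  qed (auto simp: semidirect_product_def closed \<phi>_mult mult one N.m_assoc H.m_assoc)
qed

lemma funpow_swap: "(prod.swap ^^ n) p = (if even n then p else prod.swap p)"
  by (induction n) auto

text \<open>Only the parity of the exponent of the swap matters, and reduction modulo 4 preserves it; hence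
  the swap does define an action of the cyclic group of order 4.\<close>

lemma group_C2sq_C4: "group C2sq_C4"
  unfolding C2sq_C4_def
proof (rule group_semidirect_product)
  show "prod.swap ^^ nat h \<in> hom (integer_mod_group 2 \<times>\<times> integer_mod_group 2)
      (integer_mod_group 2 \<times>\<times> integer_mod_group 2)" for h :: int
    by (auto simp: hom_def DirProd_def funpow_swap)
  show "(prod.swap ^^ nat (h \<otimes>\<^bsub>integer_mod_group 4\<^esub> h')) n =
      (prod.swap ^^ nat h) ((prod.swap ^^ nat h') n)"
    if "h \<in> carrier (integer_mod_group 4)" "h' \<in> carrier (integer_mod_group 4)"
    for h h' :: int and n :: "int \<times> int"
  proof -
    have "even (nat ((h + h') mod 4)) \<longleftrightarrow> even (h + h')"
      by (simp add: even_nat_iff) presburger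
    then show ?thesis
      using that by (auto simp: funpow_swap carrier_integer_mod_group even_nat_iff)
  qed
qed (auto intro: DirProd_group)

lemma carrier_C2sq_C4: "carrier C2sq_C4 = ({0..<2} \<times> {0..<2}) \<times> {0..<4}"
  by (simp add: C2sq_C4_def semidirect_product_def DirProd_def carrier_integer_mod_group)

text \<open>The roots of the octic will be arranged as \<pm> w k with w periodic of period 4. An element
  ((m, n), h) of the group acts by w k \<mapsto> \<pm> w (k + h), the sign being (-1)^m if the target index k + h
  is even and (-1)^n if it is odd: the cyclic factor rotates, and the factors of the Klein group
  change the signs at the even and at the odd indices.\<close>

definition sign_at :: "(int \<times> int) \<times> int \<Rightarrow> int \<Rightarrow> complex" where
  "sign_at g j = (-1) ^ nat (if even j then fst (fst g) else snd (fst g))"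

lemma sign_at_cases: "sign_at g j = 1 \<or> sign_at g j = -1"
  by (simp add: sign_at_def minus_one_power_iff)

lemma sign_at_parity: "even j \<longleftrightarrow> even k \<Longrightarrow> sign_at g j = sign_at g k"
  by (simp add: sign_at_def)

lemma snd_mult_C2sq_C4:
  "snd (g \<otimes>\<^bsub>C2sq_C4\<^esub> g') = (snd g + snd g') mod 4"
  by (simp add: C2sq_C4_def semidirect_product_def split: prod.splits)

text \<open>This is the cocycle identity that makes the signed rotations compose like the elements of the
  semidirect product: a rotation by an odd amount interchanges even and odd indices, which is the
  swap in the group law.\<close>

lemma sign_at_mult:
  assumes "g \<in> carrier C2sq_C4" "g' \<in> carrier C2sq_C4"
  shows "sign_at (g \<otimes>\<^bsub>C2sq_C4\<^esub> g') (k + snd (g \<otimes>\<^bsub>C2sq_C4\<^esub> g')) =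
    sign_at g' (k + snd g') * sign_at g (k + snd g' + snd g)"
proof -
  obtain m n h m' n' h' where g: "g = ((m, n), h)" "g' = ((m', n'), h')"
    by (metis surj_pair)
  have *: "(-1 :: complex) ^ nat ((i + j) mod 2) = (-1) ^ nat i * (-1) ^ nat j"
    if "i \<in> {0..<2}" "j \<in> {0..<2}" for i j
  proof -
    have "i = 0 \<or> i = 1" "j = 0 \<or> j = 1" using that by auto
    then show ?thesis by auto
  qed
  have mem: "m \<in> {0..<2}" "n \<in> {0..<2}" "m' \<in> {0..<2}" "n' \<in> {0..<2}" "0 \<le> h" "0 \<le> h'"
    using assms by (simp_all add: carrier_C2sq_C4 g)
  have "sign_at (g \<otimes>\<^bsub>C2sq_C4\<^esub> g') (k + snd (g \<otimes>\<^bsub>C2sq_C4\<^esub> g')) =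
      sign_at (g \<otimes>\<^bsub>C2sq_C4\<^esub> g') (k + h' + h)"
    by (rule sign_at_parity) (simp add: snd_mult_C2sq_C4 g, presburger)
  also have "\<dots> = sign_at g' (k + h') * sign_at g (k + h' + h)"
    using mem by (auto simp: g C2sq_C4_def semidirect_product_def sign_at_def
        DirProd_def funpow_swap even_nat_iff * mult.commute)
  finally show ?thesis by (simp add: g)
qed

lemma sign_at_inject:
  assumes "g \<in> carrier C2sq_C4" "g' \<in> carrier C2sq_C4" "snd g = snd g'"
    and "sign_at g j = sign_at g' j" "sign_at g (j + 1) = sign_at g' (j + 1)"
  shows "g = g'"
proof -
  obtain m n h m' n' h' where g: "g = ((m, n), h)" "g' = ((m', n'), h')"
    by (metis surj_pair)
  have "m = 0 \<or> m = 1" "n = 0 \<or> n = 1" "m' = 0 \<or> m' = 1" "n' = 0 \<or> n' = 1"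
    using assms(1,2) by (auto simp: carrier_C2sq_C4 g)
  then show ?thesis
    using assms(3-5) by (cases "even j") (auto simp: sign_at_def g)
qed

text \<open>The eight points on which the group acts, together with an enumeration by the numbers 1 to 8.\<close>

locale signed_cycle =
  fixes w :: "int \<Rightarrow> complex" and r :: "nat \<Rightarrow> complex"
  assumes period: "w (k + 4) = w k"
    and distinct: "w j = w k \<Longrightarrow> j mod 4 = k mod 4"
    and distinct_neg: "w j \<noteq> - w k"
    and enum: "bij_betw r {1..8} (range w \<union> uminus ` range w)"
begin

lemma w_mod: "j mod 4 = k mod 4 \<Longrightarrow> w j = w k"
proof -
  have *: "w (j + 4 * of_nat n) = w j" for j n
  proof (induction n)
    case (Suc n)
    then show ?case using period[of "j + 4 * of_nat n"] by (simp add: algebra_simps)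
  qed simp
  assume "j mod 4 = k mod 4"
  then obtain d where d: "j = k + 4 * d" by (metis mod_eqE mult.commute add.commute)
  show ?thesis
  proof (cases "d \<ge> 0")
    case True
    then show ?thesis using *[of k "nat d"] d by simp
  next
    case False
    then show ?thesis using *[of j "nat (- d)"] d by simp
  qed
qed

lemma signed_cancel:
  assumes "e = 1 \<or> e = -1" "e' = 1 \<or> e' = -1" "e * w j = e' * w k"
  shows "e = e' \<and> j mod 4 = k mod 4"
  using assms distinct[of j k] distinct_neg[of j k] distinct_neg[of k j] by auto

lemma enum_cases:
  assumes "i \<in> {1..8}"
  obtains e k where "e = 1 \<or> e = -1" "r i = e * w k"
proof -
  have "r i \<in> range w \<union> uminus ` range w" using enum assms by (auto simp: bij_betw_def)
  then show ?thesis using that[of 1] that[of "-1"] by auto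
qed

lemma enum_surj:
  assumes "e = 1 \<or> e = -1"
  obtains i where "i \<in> {1..8}" "r i = e * w k"
proof -
  have "e * w k \<in> range w \<union> uminus ` range w" using assms by auto
  then show ?thesis using enum that unfolding bij_betw_def by (metis imageE)
qed

definition moves :: "(int \<times> int) \<times> int \<Rightarrow> (nat \<Rightarrow> nat) \<Rightarrow> bool" where
  "moves g p \<longleftrightarrow> p permutes {1..8} \<and>
     (\<forall>i\<in>{1..8}. \<forall>k e. (e = 1 \<or> e = -1) \<longrightarrow> r i = e * w k \<longrightarrow>
        r (p i) = e * sign_at g (k + snd g) * w (k + snd g))"

lemma movesD:
  assumes "moves g p" "i \<in> {1..8}" "r i = e * w k" "e = 1 \<or> e = -1"
  shows "r (p i) = e * sign_at g (k + snd g) * w (k + snd g)"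
  using assms by (auto simp: moves_def)

lemma moves_permutes: "moves g p \<Longrightarrow> p permutes {1..8}"
  by (simp add: moves_def)

lemma moves_in: "moves g p \<Longrightarrow> i \<in> {1..8} \<Longrightarrow> p i \<in> {1..8}"
  using permutes_in_image[OF moves_permutes] by blast

lemma moves_unique:
  assumes "moves g p" "moves g p'"
  shows "p = p'"
proof
  fix i
  show "p i = p' i"
  proof (cases "i \<in> {1..8}")
    case True
    then obtain e k where "e = 1 \<or> e = -1" "r i = e * w k" by (rule enum_cases)
    then have "r (p i) = r (p' i)"
      using movesD[OF assms(1) True] movesD[OF assms(2) True] by simp
    then show ?thesis
      using inj_onD[OF bij_betw_imp_inj_on[OF enum]] moves_in[OF assms(1) True]
        moves_in[OF assms(2) True] by blast
  next
    case False
    then show ?thesis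
      using permutes_not_in[OF moves_permutes[OF assms(1)]]
        permutes_not_in[OF moves_permutes[OF assms(2)]] by simp
  qed
qed

lemma moves_inject:
  assumes "moves g p" "moves g' p" "g \<in> carrier C2sq_C4" "g' \<in> carrier C2sq_C4"
  shows "g = g'"
proof -
  have *: "sign_at g (k + snd g) = sign_at g' (k + snd g') \<and> (k + snd g) mod 4 = (k + snd g') mod 4" for k
  proof -
    obtain i where i: "i \<in> {1..8}" "r i = 1 * w k" using enum_surj[of 1 k] by auto
    have "sign_at g (k + snd g) * w (k + snd g) = sign_at g' (k + snd g') * w (k + snd g')"
      using movesD[OF assms(1) i] movesD[OF assms(2) i] by simp
    then show ?thesis by (intro signed_cancel sign_at_cases)
  qed
  have "snd g \<in> {0..<4}" "snd g' \<in> {0..<4}"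
    using assms(3,4) unfolding carrier_C2sq_C4 by auto
  then have "snd g = snd g'" using *[of 0] by simp
  then show ?thesis
    using *[of 0] *[of 1] sign_at_inject[OF assms(3,4), of "snd g"] by (simp add: add.commute)
qed

lemma moves_mult:
  assumes "moves g p" "moves g' p'" "g \<in> carrier C2sq_C4" "g' \<in> carrier C2sq_C4"
  shows "moves (g \<otimes>\<^bsub>C2sq_C4\<^esub> g') (p \<circ> p')"
  unfolding moves_def
proof (intro conjI ballI allI impI)
  let ?g = "g \<otimes>\<^bsub>C2sq_C4\<^esub> g'"
  show "p \<circ> p' permutes {1..8}"
    by (rule permutes_compose[OF moves_permutes[OF assms(2)] moves_permutes[OF assms(1)]])
  fix i k and e :: complex assume i: "i \<in> {1..8}" and e: "e = 1 \<or> e = -1" and ri: "r i = e * w k"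
  have "p' i \<in> {1..8}"
    by (rule moves_in[OF assms(2) i])
  moreover have "r (p' i) = (e * sign_at g' (k + snd g')) * w (k + snd g')"
    using movesD[OF assms(2) i ri e] by simp
  moreover have "e * sign_at g' (k + snd g') = 1 \<or> e * sign_at g' (k + snd g') = -1"
    using e sign_at_cases[of g' "k + snd g'"] by auto
  ultimately have "r (p (p' i)) = e * sign_at g' (k + snd g') *
      sign_at g (k + snd g' + snd g) * w (k + snd g' + snd g)"
    by (rule movesD[OF assms(1)])
  also have "w (k + snd g' + snd g) = w (k + snd ?g)"
    by (rule w_mod) (simp add: snd_mult_C2sq_C4 add_ac mod_add_right_eq)
  finally show "r ((p \<circ> p') i) = e * sign_at ?g (k + snd ?g) * w (k + snd ?g)"
    by (simp add: sign_at_mult[OF assms(3,4)] mult.assoc)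
qed

text \<open>If the permutations in H are exactly those by which the elements of the image of S move the
  points, then S acts faithfully through H, because an element of the large group can be read off
  from its permutation. The elements with m = n and arbitrary h already act transitively, as they
  send w k to every \<pm> w j.\<close>

lemma moves_group:
  assumes S: "group S" "\<iota> \<in> hom S C2sq_C4" "inj_on \<iota> (carrier S)"
    and diagonal: "\<And>e h. e \<in> {0..<2} \<Longrightarrow> h \<in> {0..<4} \<Longrightarrow> ((e, e), h) \<in> \<iota> ` carrier S"
    and H: "\<And>p. p \<in> H \<longleftrightarrow> (\<exists>g\<in>carrier S. moves (\<iota> g) p)"
    and ex: "\<And>g. g \<in> carrier S \<Longrightarrow> \<exists>p. moves (\<iota> g) p"
  shows "H \<in> transitive_subgroups 8" "(sym_group 8)\<lparr>carrier := H\<rparr> \<cong> S"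
proof -
  interpret S: group S by fact
  interpret C: group C2sq_C4 by (rule group_C2sq_C4)
  interpret sym: group "sym_group 8" by (rule sym_group_is_group)
  have \<iota>: "\<iota> g \<in> carrier C2sq_C4" if "g \<in> carrier S" for g
    using hom_in_carrier[OF S(2) that] .
  define \<Phi> where "\<Phi> g = (SOME p. moves (\<iota> g) p)" for g
  have \<Phi>: "moves (\<iota> g) (\<Phi> g)" if "g \<in> carrier S" for g
    unfolding \<Phi>_def using ex[OF that] by (rule someI_ex)
  have hom: "\<Phi> \<in> hom S (sym_group 8)"
  proof (rule homI)
    fix g assume "g \<in> carrier S"
    then show "\<Phi> g \<in> carrier (sym_group 8)"
      using \<Phi> by (simp add: sym_group_carrier moves_def)
  next
    fix g g' assume g: "g \<in> carrier S" "g' \<in> carrier S"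
    have "moves (\<iota> (g \<otimes>\<^bsub>S\<^esub> g')) (\<Phi> g \<circ> \<Phi> g')"
      using moves_mult[OF \<Phi>[OF g(1)] \<Phi>[OF g(2)]] g \<iota> hom_mult[OF S(2)] by simp
    then show "\<Phi> (g \<otimes>\<^bsub>S\<^esub> g') = \<Phi> g \<otimes>\<^bsub>sym_group 8\<^esub> \<Phi> g'"
      using moves_unique \<Phi> g by (simp add: sym_group_mult) (metis S.m_closed)
  qed
  have image: "\<Phi> ` carrier S = H"
  proof (intro equalityI subsetI)
    fix p assume "p \<in> H"
    then obtain g where "g \<in> carrier S" "moves (\<iota> g) p" using H by blast
    then show "p \<in> \<Phi> ` carrier S" using \<Phi> moves_unique by blast
  qed (use H \<Phi> in auto)
  have inj: "inj_on \<Phi> (carrier S)"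
  proof (rule inj_onI)
    fix g g' assume g: "g \<in> carrier S" "g' \<in> carrier S" "\<Phi> g = \<Phi> g'"
    then have "\<iota> g = \<iota> g'" using moves_inject[OF \<Phi>[OF g(1)], of "\<iota> g'"] \<Phi>[OF g(2)] \<iota> by simp
    then show "g = g'" using S(3) g by (meson inj_onD)
  qed
  interpret \<Phi>: group_hom S "sym_group 8" \<Phi>
    by unfold_locales (rule hom)
  have sub: "subgroup H (sym_group 8)"
    using \<Phi>.img_is_subgroup by (simp add: image)
  show "H \<in> transitive_subgroups 8"
    unfolding transitive_subgroups_def
  proof (intro CollectI conjI ballI sub)
    fix i j :: nat assume ij: "i \<in> {1..8}" "j \<in> {1..8}"
    obtain e k e' k' where e: "e = 1 \<or> e = -1" "r i = e * w k" and e': "e' = 1 \<or> e' = -1" "r j = e' * w k'"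
      using enum_cases[OF ij(1)] enum_cases[OF ij(2)] by metis
    define h where "h = (k' - k) mod 4"
    define d :: int where "d = (if e = e' then 0 else 1)"
    have "((d, d), h) \<in> \<iota> ` carrier S"
      by (rule diagonal) (auto simp: d_def h_def)
    then obtain g where g: "g \<in> carrier S" "\<iota> g = ((d, d), h)" by force
    have "r (\<Phi> g i) = e * (-1) ^ nat d * w (k + h)"
      using movesD[OF \<Phi>[OF g(1)] ij(1) e(2,1)] by (simp add: g sign_at_def)
    also have "e * (-1) ^ nat d = e'" using e e' by (auto simp: d_def)
    also have "w (k + h) = w k'"
      by (rule w_mod) (simp add: h_def mod_add_right_eq)
    finally have "r (\<Phi> g i) = r j" using e' by simp
    moreover have "\<Phi> g i \<in> {1..8}"
      by (rule moves_in[OF \<Phi>[OF g(1)] ij(1)])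
    ultimately have "\<Phi> g i = j"
      using inj_onD[OF bij_betw_imp_inj_on[OF enum]] ij(2) by blast
    moreover have "\<Phi> g \<in> H" using image g by blast
    ultimately show "\<exists>p\<in>H. p i = j" by blast
  qed
  have "\<Phi> \<in> iso S ((sym_group 8)\<lparr>carrier := H\<rparr>)"
    using hom image inj by (auto simp: iso_def hom_def bij_betw_def)
  then show "(sym_group 8)\<lparr>carrier := H\<rparr> \<cong> S"
    using S.iso_set_sym is_isoI by blast
qed

end

lemma hom_diagonal:
  "(\<lambda>(h, e). ((e, e), h)) \<in> hom (integer_mod_group 4 \<times>\<times> integer_mod_group 2) C2sq_C4"
  by (auto simp: hom_def DirProd_def C2sq_C4_def semidirect_product_def funpow_swap
      carrier_integer_mod_group)

section \<open>The roots of a palindromic even octic\<close>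

text \<open>Dividing f(x) by x^4 gives a quadratic polynomial in x^2 + 1/x^2. Let x and z be roots of f
  belonging to its two different zeros. The square of the left-hand side of the relation assumed
  last below is (b + 2)^2 - 4 a^2, and the square of the difference of the two zeros is a^2 - 4 b + 8.
  The product of these numbers being a rational square, the two quantities themselves differ by a
  rational factor c. This relation between x and z is what makes the Galois group small.\<close>

locale octic =
  fixes a b :: rat and f :: "rat poly" and x z c :: complex
  assumes f: "f = [:1, 0, a, 0, b, 0, a, 0, 1:]"
    and irreducible: "Factorial_Ring.irreducible f"
    and nonzero: "x \<noteq> 0" "z \<noteq> 0"
    and trace_sum: "(x\<^sup>2 + 1 / x\<^sup>2) + (z\<^sup>2 + 1 / z\<^sup>2) = - of_rat a"
    and trace_prod: "(x\<^sup>2 + 1 / x\<^sup>2) * (z\<^sup>2 + 1 / z\<^sup>2) = of_rat b - 2"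
    and trace_distinct: "x\<^sup>2 + 1 / x\<^sup>2 \<noteq> z\<^sup>2 + 1 / z\<^sup>2"
    and c: "c \<in> \<rat>"
    and relation: "(x\<^sup>2 - 1 / x\<^sup>2) * (z\<^sup>2 - 1 / z\<^sup>2) = c * ((x\<^sup>2 + 1 / x\<^sup>2) - (z\<^sup>2 + 1 / z\<^sup>2))"
    and relation_nonzero: "(x\<^sup>2 - 1 / x\<^sup>2) * (z\<^sup>2 - 1 / z\<^sup>2) \<noteq> 0"

text \<open>The two zeros t and t' differ: otherwise t would be rational, and x would be a root of
  the rational polynomial X^4 - t X^2 + 1 of degree less than that of its minimal polynomial.\<close>

lemma exists_octic:
  fixes a b k :: rat and f :: "rat poly"
  assumes f: "f = [:1, 0, a, 0, b, 0, a, 0, 1:]" and irr: "Factorial_Ring.irreducible f"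
    and nz: "(b + 2)\<^sup>2 - 4 * a\<^sup>2 \<noteq> 0"
    and k: "(a\<^sup>2 - 4 * b + 8) * ((b + 2)\<^sup>2 - 4 * a\<^sup>2) = k\<^sup>2"
  obtains x z c where "octic a b f x z c"
proof -
  define A B :: complex where AB: "A = of_rat a" "B = of_rat b"
  have "degree (map_poly (of_rat :: rat \<Rightarrow> complex) f) = 8"
    by (simp add: degree_map_poly f)
  then have "\<not> constant (poly (map_poly (of_rat :: rat \<Rightarrow> complex) f))"
    by (simp add: constant_degree)
  then obtain x where x: "ev f x = 0"
    using fundamental_theorem_of_algebra by blast
  have f_x: "1 + A * x\<^sup>2 + B * x ^ 4 + A * x ^ 6 + x ^ 8 = 0"
    using x by (simp add: f AB algebra_simps power_numeral_reduce)
  then have x0: "x \<noteq> 0" by auto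
  define t where "t = x\<^sup>2 + 1 / x\<^sup>2"
  define t' where "t' = - A - t"
  have "x ^ 4 * (t\<^sup>2 + A * t + B - 2) = 1 + A * x\<^sup>2 + B * x ^ 4 + A * x ^ 6 + x ^ 8"
    using x0 by (simp add: t_def field_simps power_numeral_reduce)
  then have t: "t\<^sup>2 + A * t + B - 2 = 0" using f_x x0 by simp
  then have prod: "t * t' = B - 2" by (simp add: t'_def algebra_simps power2_eq_square)
  have disc: "(t - t')\<^sup>2 = A\<^sup>2 - 4 * B + 8"
  proof -
    have "(t - t')\<^sup>2 = (t + t')\<^sup>2 - 4 * (t * t')" by (simp add: power2_eq_square algebra_simps)
    then show ?thesis unfolding prod by (simp add: t'_def)
  qed
  have "t \<noteq> t'"
  proof
    assume "t = t'"
    then have "2 * t + A = 0" by (simp add: t'_def)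
    then have "x ^ 4 + A / 2 * x\<^sup>2 + 1 = 0"
      using x0 by (simp add: t_def field_simps power_numeral_reduce)
    then have "ev [:1, 0, a / 2, 0, 1:] x = 0"
      by (simp add: AB of_rat_divide algebra_simps power_numeral_reduce)
    then have "f dvd [:1, 0, a / 2, 0, 1:]"
      using irreducible_root_dvd[OF irr x] by blast
    then have "degree f \<le> degree [:1, 0, a / 2, 0, 1:]" by (rule dvd_imp_degree_le) simp
    then show False by (simp add: f)
  qed
  define y where "y = (t' + csqrt (t'\<^sup>2 - 4)) / 2"
  define z where "z = csqrt y"
  have "(2 * y - t')\<^sup>2 = t'\<^sup>2 - 4" by (simp add: y_def)
  then have "4 * (y\<^sup>2 + 1) = 4 * (t' * y)" by (simp add: power2_eq_square algebra_simps)
  then have y: "y\<^sup>2 + 1 = t' * y" by (subst (asm) mult_cancel_left) simp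
  then have "y \<noteq> 0" by auto
  then have z0: "z \<noteq> 0" by (simp add: z_def)
  have z: "z\<^sup>2 + 1 / z\<^sup>2 = t'"
  proof -
    have "z\<^sup>2 = y" by (simp add: z_def)
    moreover have "y + 1 / y = t'" using y \<open>y \<noteq> 0\<close> by (simp add: field_simps power2_eq_square)
    ultimately show ?thesis by simp
  qed
  define L where "L = (x\<^sup>2 - 1 / x\<^sup>2) * (z\<^sup>2 - 1 / z\<^sup>2)"
  have sq: "(u\<^sup>2 - 1 / u\<^sup>2)\<^sup>2 = (u\<^sup>2 + 1 / u\<^sup>2)\<^sup>2 - 4" if "u \<noteq> 0" for u :: complex
    using that by (simp add: field_simps power2_eq_square)
  have L2: "L\<^sup>2 = (B + 2)\<^sup>2 - 4 * A\<^sup>2"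
  proof -
    have "L\<^sup>2 = (t\<^sup>2 - 4) * (t'\<^sup>2 - 4)"
      by (simp add: L_def power_mult_distrib sq x0 z0 z flip: t_def)
    also have "\<dots> = (t * t')\<^sup>2 - 4 * ((t + t')\<^sup>2 - 2 * (t * t')) + 16"
      by (simp add: power2_eq_square algebra_simps)
    also have "\<dots> = (B + 2)\<^sup>2 - 4 * A\<^sup>2"
      unfolding prod by (simp add: t'_def power2_eq_square algebra_simps)
    finally show ?thesis .
  qed
  also have "\<dots> = of_rat ((b + 2)\<^sup>2 - 4 * a\<^sup>2)"
    by (simp add: AB of_rat_add of_rat_diff of_rat_mult of_rat_power)
  finally have "L \<noteq> 0" using nz by auto
  have "(L * (t - t'))\<^sup>2 = (of_rat k)\<^sup>2"
  proof -
    have "(L * (t - t'))\<^sup>2 = (A\<^sup>2 - 4 * B + 8) * ((B + 2)\<^sup>2 - 4 * A\<^sup>2)"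
      by (simp add: power_mult_distrib L2 disc)
    also have "\<dots> = of_rat ((a\<^sup>2 - 4 * b + 8) * ((b + 2)\<^sup>2 - 4 * a\<^sup>2))"
      by (simp add: AB of_rat_add of_rat_diff of_rat_mult of_rat_power)
    finally show ?thesis by (simp add: k of_rat_power)
  qed
  then have "L * (t - t') = of_rat k \<or> L * (t - t') = of_rat (- k)"
    by (simp add: power2_eq_iff of_rat_minus)
  then obtain k' where k': "L * (t - t') = of_rat k'" by blast
  define c :: complex where "c = of_rat (k' / (a\<^sup>2 - 4 * b + 8))"
  have "c = L * (t - t') / (t - t')\<^sup>2"
    by (simp add: c_def k' disc AB of_rat_add of_rat_diff of_rat_mult of_rat_power of_rat_divide)
  then have "L = c * (t - t')"
    using \<open>t \<noteq> t'\<close> by (simp add: power2_eq_square)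
  then have "octic a b f x z c"
    using f irr x0 z0 z prod \<open>t \<noteq> t'\<close> \<open>L \<noteq> 0\<close>
    by unfold_locales (simp_all add: c_def AB t'_def L_def flip: t_def)
  then show ?thesis by (rule that)
qed

context octic
begin

lemma f_nonzero: "f \<noteq> 0" and degree_f: "degree f = 8"
  by (simp_all add: f)

lemma factor: "y \<noteq> 0 \<Longrightarrow> ev f y =
  y ^ 4 * ((y\<^sup>2 + 1 / y\<^sup>2) - (x\<^sup>2 + 1 / x\<^sup>2)) * ((y\<^sup>2 + 1 / y\<^sup>2) - (z\<^sup>2 + 1 / z\<^sup>2))"
proof -
  assume y: "y \<noteq> 0"
  have "ev f y = y ^ 4 * ((y\<^sup>2 + 1 / y\<^sup>2)\<^sup>2 - (- of_rat a) * (y\<^sup>2 + 1 / y\<^sup>2) + (of_rat b - 2))"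
    using y by (simp add: f field_simps power_numeral_reduce)
  moreover have "Y * (T\<^sup>2 - (p + q) * T + p * q) = Y * (T - p) * (T - q)" for Y T p q :: complex
    by (simp add: algebra_simps power2_eq_square)
  ultimately show ?thesis
    unfolding trace_sum[symmetric] trace_prod[symmetric] by simp
qed

lemma square_cases:
  fixes y u :: complex
  assumes "y \<noteq> 0" "u \<noteq> 0" "y\<^sup>2 + 1 / y\<^sup>2 = u\<^sup>2 + 1 / u\<^sup>2"
  shows "y = u \<or> y = - u \<or> y = 1 / u \<or> y = - (1 / u)"
proof -
  have "(y\<^sup>2 - u\<^sup>2) * ((y * u)\<^sup>2 - 1) = (y * u)\<^sup>2 * ((y\<^sup>2 + 1 / y\<^sup>2) - (u\<^sup>2 + 1 / u\<^sup>2))"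
    using assms(1,2) by (simp add: field_simps power2_eq_square)
  then have "y\<^sup>2 = u\<^sup>2 \<or> (y * u)\<^sup>2 = 1" using assms(3) by auto
  then have "y = u \<or> y = - u \<or> y * u = 1 \<or> (- y) * u = 1"
    by (simp add: power2_eq_iff power2_eq_1_iff minus_equation_iff[of _ 1] eq_commute[of "- 1"])
  moreover have "v = 1 / u" if "v * u = 1" for v
    using assms(2) that by (simp add: nonzero_eq_divide_eq)
  ultimately show ?thesis by (metis minus_minus)
qed

lemma croots_f: "croots f = {x, - x, 1 / x, - (1 / x), z, - z, 1 / z, - (1 / z)}"
proof (intro equalityI subsetI)
  fix y assume "y \<in> croots f"
  then have y: "ev f y = 0" by (simp add: croots_ev)
  then have "y \<noteq> 0" by (auto simp: f)
  then show "y \<in> {x, - x, 1 / x, - (1 / x), z, - z, 1 / z, - (1 / z)}"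
  proof -
    have "y\<^sup>2 + 1 / y\<^sup>2 = x\<^sup>2 + 1 / x\<^sup>2 \<or> y\<^sup>2 + 1 / y\<^sup>2 = z\<^sup>2 + 1 / z\<^sup>2"
      using y factor[OF \<open>y \<noteq> 0\<close>] \<open>y \<noteq> 0\<close> by simp
    then show ?thesis
      using square_cases[OF \<open>y \<noteq> 0\<close> nonzero(1)] square_cases[OF \<open>y \<noteq> 0\<close> nonzero(2)] by blast
  qed
next
  fix y assume y: "y \<in> {x, - x, 1 / x, - (1 / x), z, - z, 1 / z, - (1 / z)}"
  have *: "v \<noteq> 0 \<and> v\<^sup>2 + 1 / v\<^sup>2 = u\<^sup>2 + 1 / u\<^sup>2"
    if "u \<noteq> 0" "v \<in> {u, - u, 1 / u, - (1 / u)}" for u v :: complex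
    using that by (auto simp: power_divide)
  have "y \<in> {x, - x, 1 / x, - (1 / x)} \<or> y \<in> {z, - z, 1 / z, - (1 / z)}" using y by blast
  then have "ev f y = 0"
    using *[OF nonzero(1), of y] *[OF nonzero(2), of y] factor[of y] by (elim disjE) simp_all
  then show "y \<in> croots f" by (simp add: croots_ev)
qed

lemma root_x: "ev f x = 0"
proof -
  have "x \<in> croots f" by (simp add: croots_f)
  then show ?thesis by (simp add: croots_ev)
qed

lemma squares_distinct:
  "x\<^sup>2 \<noteq> 1 / x\<^sup>2" "z\<^sup>2 \<noteq> 1 / z\<^sup>2" "x\<^sup>2 \<noteq> z\<^sup>2" "x\<^sup>2 \<noteq> 1 / z\<^sup>2" "1 / x\<^sup>2 \<noteq> z\<^sup>2"
proof -
  show "x\<^sup>2 \<noteq> 1 / x\<^sup>2" "z\<^sup>2 \<noteq> 1 / z\<^sup>2"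
    using relation_nonzero by (simp_all only: mult_eq_0_iff de_Morgan_disj right_minus_eq not_False_eq_True)
  have inverse: "u + 1 / u = v + 1 / v" if "u = v \<or> u = 1 / v" for u v :: complex
    using that by auto
  show "x\<^sup>2 \<noteq> z\<^sup>2" "x\<^sup>2 \<noteq> 1 / z\<^sup>2"
    using trace_distinct inverse by blast+
  show "1 / x\<^sup>2 \<noteq> z\<^sup>2"
  proof
    assume "1 / x\<^sup>2 = z\<^sup>2"
    from this[symmetric] have "x\<^sup>2 = 1 / z\<^sup>2" by simp
    with \<open>x\<^sup>2 \<noteq> 1 / z\<^sup>2\<close> show False by contradiction
  qed
qed

text \<open>The parameter \<delta> = 1 or -1 chooses between two cyclic arrangements of the roots up to sign. Both
  are needed: one is suited to the case that b + 2 - 2a is a square, the other to b + 2 + 2a.\<close>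

definition w :: "complex \<Rightarrow> int \<Rightarrow> complex" where
  "w \<delta> k = (if k mod 4 = 0 then x else if k mod 4 = 1 then z
     else if k mod 4 = 2 then \<delta> / x else \<delta> / z)"

lemma mod4_cases:
  fixes k :: int
  obtains "k mod 4 = 0" | "k mod 4 = 1" | "k mod 4 = 2" | "k mod 4 = 3"
  using pos_mod_bound[of 4 k] pos_mod_sign[of 4 k] by linarith

lemma w_cong: "j mod 4 = k mod 4 \<Longrightarrow> w \<delta> j = w \<delta> k"
  by (simp add: w_def)

lemma w_add_2:
  assumes "\<delta> = 1 \<or> \<delta> = -1"
  shows "w \<delta> (k + 2) = \<delta> / w \<delta> k"
proof -
  have "(k + 2) mod 4 = (k mod 4 + 2) mod 4" by (simp add: mod_add_left_eq)
  then show ?thesis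
    by (cases k rule: mod4_cases) (use assms nonzero in \<open>auto simp: w_def\<close>)
qed

lemma w_squares_inj:
  assumes "\<delta> = 1 \<or> \<delta> = -1" "(w \<delta> j)\<^sup>2 = (w \<delta> k)\<^sup>2"
  shows "j mod 4 = k mod 4"
proof -
  define p p' q q' where p: "p = x\<^sup>2" and p': "p' = 1 / x\<^sup>2" and q: "q = z\<^sup>2" and q': "q' = 1 / z\<^sup>2"
  have "(w \<delta> l)\<^sup>2 = (if l mod 4 = 0 then p else if l mod 4 = 1 then q
      else if l mod 4 = 2 then p' else q')" for l
    using assms(1) by (auto simp: w_def power_divide p p' q q')
  moreover have "p \<noteq> p'" "q \<noteq> q'" "p \<noteq> q" "p \<noteq> q'" "p' \<noteq> q" "p' \<noteq> q'"
    using squares_distinct unfolding p p' q q' by simp_all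
  ultimately show ?thesis
    using assms(2) by (cases j rule: mod4_cases; cases k rule: mod4_cases) simp_all
qed

lemma w_nonzero: "\<delta> = 1 \<or> \<delta> = -1 \<Longrightarrow> w \<delta> k \<noteq> 0"
  using nonzero by (auto simp: w_def)

lemma range_w: "range (w \<delta>) = {x, z, \<delta> / x, \<delta> / z}"
proof
  show "{x, z, \<delta> / x, \<delta> / z} \<subseteq> range (w \<delta>)"
    using rangeI[of "w \<delta>" 0] rangeI[of "w \<delta>" 1] rangeI[of "w \<delta>" 2] rangeI[of "w \<delta>" 3]
    by (simp add: w_def)
qed (auto simp: w_def)

lemma croots_w: "\<delta> = 1 \<or> \<delta> = -1 \<Longrightarrow> croots f = range (w \<delta>) \<union> uminus ` range (w \<delta>)"
  unfolding croots_f range_w by (elim disjE; simp; blast)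

lemma signed_cycle_w:
  assumes "\<delta> = 1 \<or> \<delta> = -1" "bij_betw r {1..8} (croots f)"
  shows "signed_cycle (w \<delta>) r"
proof
  show "w \<delta> j \<noteq> - w \<delta> k" for j k
  proof
    assume neg: "w \<delta> j = - w \<delta> k"
    then have "w \<delta> j = w \<delta> k" by (intro w_cong w_squares_inj[OF assms(1)]) simp
    then show False using neg w_nonzero[OF assms(1), of k] by simp
  qed
  show "w \<delta> (k + 4) = w \<delta> k" for k by (rule w_cong) simp
  show "j mod 4 = k mod 4" if "w \<delta> j = w \<delta> k" for j k
    using w_squares_inj[OF assms(1), of j k] that by simp
  show "bij_betw r {1..8} (range (w \<delta>) \<union> uminus ` range (w \<delta>))"
    using assms(2) unfolding croots_w[OF assms(1)] .
qed

lemma croots_signed: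
  assumes "\<delta> = 1 \<or> \<delta> = -1" "y \<in> croots f"
  obtains e h where "e = 1 \<or> e = -1" "h \<in> {0..<4}" "y = e * w \<delta> h"
proof -
  have "y \<in> range (w \<delta>) \<union> uminus ` range (w \<delta>)"
    using assms(2) croots_w[OF assms(1)] by blast
  then obtain k where "y = w \<delta> k \<or> y = - w \<delta> k" by blast
  then have "y = 1 * w \<delta> k \<or> y = (-1) * w \<delta> k" by (simp only: mult_1 mult_minus1)
  then obtain e where e: "e = 1 \<or> e = -1" and y: "y = e * w \<delta> k" by blast
  show ?thesis
  proof (rule that[OF e])
    show "k mod 4 \<in> {0..<4}" by simp
    show "y = e * w \<delta> (k mod 4)" unfolding y by (rule arg_cong, rule w_cong) simp
  qed
qed

lemma signed_croots:
  assumes "\<delta> = 1 \<or> \<delta> = -1" "e = 1 \<or> e = -1"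
  shows "e * w \<delta> k \<in> croots f"
  using assms(2) unfolding croots_w[OF assms(1)] by auto

lemma card_croots: "card (croots f) = 8"
proof -
  have "inj_on (\<lambda>(e, k). e * w 1 k) ({1, -1} \<times> {0..<4})"
  proof (rule inj_onI, clarify)
    fix e e' :: complex and j k :: int
    assume e: "e \<in> {1, -1}" "e' \<in> {1, -1}" and jk: "j \<in> {0..<4}" "k \<in> {0..<4}"
      and eq: "e * w 1 j = e' * w 1 k"
    have "(w 1 j)\<^sup>2 = (e * w 1 j)\<^sup>2" using e by auto
    also have "\<dots> = (w 1 k)\<^sup>2" unfolding eq using e by auto
    finally have "j = k" using w_squares_inj[of 1 j k] jk by simp
    then show "e = e' \<and> j = k" using eq w_nonzero[of 1 k] by simp
  qed
  moreover have "(\<lambda>(e, k). e * w 1 k) ` ({1, -1} \<times> {0..<4}) = croots f"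
  proof (intro equalityI subsetI)
    fix y assume "y \<in> croots f"
    then obtain e h where "e = 1 \<or> e = -1" "h \<in> {0..<4}" "y = e * w 1 h"
      using croots_signed[of 1 y] by blast
    then show "y \<in> (\<lambda>(e, k). e * w 1 k) ` ({1, -1} \<times> {0..<4})" by force
  qed (use signed_croots[of 1] in auto)
  ultimately have "card (croots f) = card ({1, -1 :: complex} \<times> {0..<4 :: int})"
    using card_image by fastforce
  then show ?thesis by (simp add: card_insert_if)
qed

definition acts :: "complex \<Rightarrow> (int \<times> int) \<times> int \<Rightarrow> (complex \<Rightarrow> complex) \<Rightarrow> bool" where
  "acts \<delta> g \<tau> \<longleftrightarrow> (\<forall>k. \<tau> (w \<delta> k) = sign_at g (k + snd g) * w \<delta> (k + snd g))"

text \<open>An embedding sends x to some \<pm> w h and z to some \<pm> w h'. Applying it to the relation between x and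
  z forces h' = h + 1: if h and h' have the same parity, the right-hand side vanishes and the left
  one does not, and for h' = h + 3 the relation would hold with the opposite sign. Therefore each
  embedding is given by an element of the group of order 16.\<close>

lemma embedding_acts:
  assumes \<delta>: "\<delta> = 1 \<or> \<delta> = -1" and E: "complex_subfield E" "x \<in> E" "z \<in> E"
    and \<tau>: "embedding E \<tau>"
  obtains g where "g \<in> carrier C2sq_C4" "acts \<delta> g \<tau>"
proof -
  have \<delta>E: "\<delta> \<in> E" "\<tau> \<delta> = \<delta>"
    using \<delta> subfield_Rats[OF E(1)] embedding_Rats[OF E(1) \<tau>] by auto
  have wE: "w \<delta> k \<in> E" for k
    using E(2,3) \<delta>E by (simp add: w_def subfield_divide[OF E(1)])
  have root: "\<tau> y \<in> croots f" if "y \<in> E" "y \<in> croots f" for y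
    using embedding_ev[OF E(1) \<tau> that(1), of f] that(2) embedding_0[OF E(1) \<tau>]
    by (simp add: croots_ev)
  obtain e h where e: "e = 1 \<or> e = -1" and h: "h \<in> {0..<4}" and \<tau>x: "\<tau> x = e * w \<delta> h"
    using root[OF E(2)] croots_signed[OF \<delta>] by (auto simp: croots_f)
  obtain e' h' where e': "e' = 1 \<or> e' = -1" and h': "h' \<in> {0..<4}" and \<tau>z: "\<tau> z = e' * w \<delta> h'"
    using root[OF E(3)] croots_signed[OF \<delta>] by (auto simp: croots_f)
  have h'_eq: "h' mod 4 = (h + 1) mod 4"
  proof -
    define d t where "d k = (w \<delta> k)\<^sup>2 - 1 / (w \<delta> k)\<^sup>2" and "t k = (w \<delta> k)\<^sup>2 + 1 / (w \<delta> k)\<^sup>2" for k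
    have d01: "d 0 = x\<^sup>2 - 1 / x\<^sup>2" "d 1 = z\<^sup>2 - 1 / z\<^sup>2" "t 0 = x\<^sup>2 + 1 / x\<^sup>2" "t 1 = z\<^sup>2 + 1 / z\<^sup>2"
      by (simp_all add: d_def t_def w_def)
    have d: "d 2 = - d 0" "d 3 = - d 1" "t 2 = t 0" "t 3 = t 1"
      using \<delta> unfolding d01 by (auto simp: d_def t_def w_def power_divide)
    have "d 0 * d 1 = c * (t 0 - t 1)" "d 0 * d 1 \<noteq> 0"
      using relation relation_nonzero unfolding d01 by blast+
    then have d_nonzero: "d 0 \<noteq> 0" "d 1 \<noteq> 0" and rel: "c * t 1 = c * t 0 - d 0 * d 1"
      by (simp_all add: algebra_simps)
    have "\<tau> ((x\<^sup>2 - 1 / x\<^sup>2) * (z\<^sup>2 - 1 / z\<^sup>2)) = \<tau> (c * ((x\<^sup>2 + 1 / x\<^sup>2) - (z\<^sup>2 + 1 / z\<^sup>2)))"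
      by (simp only: relation)
    then have "((\<tau> x)\<^sup>2 - 1 / (\<tau> x)\<^sup>2) * ((\<tau> z)\<^sup>2 - 1 / (\<tau> z)\<^sup>2) =
        c * (((\<tau> x)\<^sup>2 + 1 / (\<tau> x)\<^sup>2) - ((\<tau> z)\<^sup>2 + 1 / (\<tau> z)\<^sup>2))"
      using E c by (simp add: subfield_intros[OF E(1)] embedding_add[OF E(1) \<tau>]
          embedding_mult[OF E(1) \<tau>] embedding_diff[OF E(1) \<tau>] embedding_divide[OF E(1) \<tau>]
          embedding_power[OF E(1) \<tau>] embedding_Rats[OF E(1) \<tau>] embedding_1[OF E(1) \<tau>])
    moreover have "(\<tau> x)\<^sup>2 = (w \<delta> h)\<^sup>2" "(\<tau> z)\<^sup>2 = (w \<delta> h')\<^sup>2"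
      using e e' by (auto simp: \<tau>x \<tau>z)
    ultimately have "d h * d h' = c * (t h - t h')" by (simp add: d_def t_def)
    moreover have "h = 0 \<or> h = 1 \<or> h = 2 \<or> h = 3" "h' = 0 \<or> h' = 1 \<or> h' = 2 \<or> h' = 3"
      using h h' by auto
    ultimately show ?thesis
      using d d_nonzero rel by (elim disjE) (auto simp: algebra_simps)
  qed
  \<comment> \<open>The first sign of a group element belongs to the even target indices, so the signs at h
      and h + 1 have to be exchanged if h is odd.\<close>
  define i i' :: int where "i = (if e = 1 then 0 else 1)" and "i' = (if e' = 1 then 0 else 1)"
  define g where "g = ((if even h then (i, i') else (i', i)), h)"
  have g: "g \<in> carrier C2sq_C4" "snd g = h"
    using h by (auto simp: g_def carrier_C2sq_C4 i_def i'_def)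
  have "sign_at g h = e" "sign_at g (h + 1) = e'"
    using e e' by (auto simp: g_def sign_at_def i_def i'_def)
  then have 01: "\<tau> (w \<delta> 0) = sign_at g (0 + h) * w \<delta> (0 + h)"
      "\<tau> (w \<delta> 1) = sign_at g (1 + h) * w \<delta> (1 + h)"
    using \<tau>x \<tau>z w_cong[OF h'_eq] by (simp_all add: w_def[of \<delta> 0] w_def[of \<delta> 1] add.commute)
  have step: "\<tau> (w \<delta> (k + 2)) = sign_at g (k + 2 + h) * w \<delta> (k + 2 + h)"
    if "\<tau> (w \<delta> k) = sign_at g (k + h) * w \<delta> (k + h)" for k
  proof -
    have "\<tau> (w \<delta> (k + 2)) = \<delta> / \<tau> (w \<delta> k)"
      using wE \<delta>E by (simp add: w_add_2[OF \<delta>] embedding_divide[OF E(1) \<tau>])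
    also have "\<dots> = sign_at g (k + h) * (\<delta> / w \<delta> (k + h))"
      using that sign_at_cases[of g "k + h"] by auto
    also have "\<delta> / w \<delta> (k + h) = w \<delta> (k + 2 + h)"
      using w_add_2[OF \<delta>, of "k + h"] by (simp add: algebra_simps)
    also have "sign_at g (k + h) = sign_at g (k + 2 + h)" by (rule sign_at_parity) simp
    finally show ?thesis .
  qed
  have "acts \<delta> g \<tau>"
    unfolding acts_def g(2)
  proof
    fix k
    have "\<tau> (w \<delta> (k mod 4)) = sign_at g (k mod 4 + h) * w \<delta> (k mod 4 + h)"
      using 01 step[of 0] step[of 1] by (cases k rule: mod4_cases) simp_all
    moreover have "w \<delta> (k mod 4) = w \<delta> k" "w \<delta> (k mod 4 + h) = w \<delta> (k + h)"
      by (rule w_cong, simp add: mod_add_left_eq)+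
    moreover have "sign_at g (k mod 4 + h) = sign_at g (k + h)"
      by (rule sign_at_parity) presburger
    ultimately show "\<tau> (w \<delta> k) = sign_at g (k + h) * w \<delta> (k + h)" by simp
  qed
  with g(1) show ?thesis by (rule that)
qed

text \<open>Together with x this element generates the splitting field. Its square is the rational number
  b + 2 - 2 \<delta> a, so it decides between the two cases of the theorem.\<close>

definition s :: "complex \<Rightarrow> complex" where
  "s \<delta> = (x + \<delta> / x) * (z + \<delta> / z)"

lemma s_squared: "\<delta> = 1 \<or> \<delta> = -1 \<Longrightarrow> (s \<delta>)\<^sup>2 = of_rat b + 2 - 2 * \<delta> * of_rat a"
proof -
  assume \<delta>: "\<delta> = 1 \<or> \<delta> = -1"
  have sq: "(u + \<delta> / u)\<^sup>2 = u\<^sup>2 + 1 / u\<^sup>2 + 2 * \<delta>" if "u \<noteq> 0" for u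
    using \<delta> that by (auto simp: power2_sum power2_diff power_divide)
  have "(s \<delta>)\<^sup>2 = (x\<^sup>2 + 1 / x\<^sup>2 + 2 * \<delta>) * (z\<^sup>2 + 1 / z\<^sup>2 + 2 * \<delta>)"
    by (simp add: s_def power_mult_distrib sq nonzero)
  also have "\<dots> = (x\<^sup>2 + 1 / x\<^sup>2) * (z\<^sup>2 + 1 / z\<^sup>2) +
      2 * \<delta> * ((x\<^sup>2 + 1 / x\<^sup>2) + (z\<^sup>2 + 1 / z\<^sup>2)) + 4 * \<delta>\<^sup>2"
    by (simp add: algebra_simps power2_eq_square)
  also have "\<dots> = of_rat b + 2 - 2 * \<delta> * of_rat a"
    unfolding trace_sum trace_prod using \<delta> by auto
  finally show ?thesis .
qed

lemma factors_nonzero: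
  assumes "\<delta> = 1 \<or> \<delta> = -1"
  shows "x + \<delta> / x \<noteq> 0" "z + \<delta> / z \<noteq> 0"
proof -
  have factor: "u\<^sup>2 - 1 / u\<^sup>2 = (u + \<delta> / u) * (u - \<delta> / u)" if "u \<noteq> 0" for u
    using assms that by (auto simp: algebra_simps power2_eq_square)
  show "x + \<delta> / x \<noteq> 0" "z + \<delta> / z \<noteq> 0"
    using relation_nonzero unfolding factor[OF nonzero(1)] factor[OF nonzero(2)]
    by (simp_all only: mult_eq_0_iff de_Morgan_disj not_False_eq_True)
qed

text \<open>Rotation permutes the two factors w 0 + w 2 and w 1 + w 3 of s \<delta>, so only the signs remain: the
  element ((m, n), h) multiplies s \<delta> by (-1)^(m + n).\<close>

lemma acts_s:
  assumes \<delta>: "\<delta> = 1 \<or> \<delta> = -1" and E: "complex_subfield E" "x \<in> E" "z \<in> E"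
    and \<tau>: "embedding E \<tau>" and acts: "acts \<delta> g \<tau>"
  shows "\<tau> (s \<delta>) = sign_at g (snd g) * sign_at g (snd g + 1) * s \<delta>"
proof -
  have \<delta>E: "\<delta> \<in> E" "\<tau> \<delta> = \<delta>"
    using \<delta> subfield_Rats[OF E(1)] embedding_Rats[OF E(1) \<tau>] by auto
  have wE: "w \<delta> k \<in> E" for k
    using E(2,3) \<delta>E by (simp add: w_def subfield_divide[OF E(1)])
  define h where "h = snd g"
  have s_cycle: "s \<delta> = (w \<delta> h + w \<delta> (h + 2)) * (w \<delta> (h + 1) + w \<delta> (h + 3))" for h
  proof -
    have "(h + 1) mod 4 = (h mod 4 + 1) mod 4" "(h + 2) mod 4 = (h mod 4 + 2) mod 4"
      "(h + 3) mod 4 = (h mod 4 + 3) mod 4" by (simp_all add: mod_add_left_eq)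
    then show ?thesis
      by (cases h rule: mod4_cases) (simp_all add: s_def w_def algebra_simps)
  qed
  have "\<tau> (s \<delta>) = (\<tau> (w \<delta> 0) + \<tau> (w \<delta> 2)) * (\<tau> (w \<delta> 1) + \<tau> (w \<delta> 3))"
    using wE by (simp add: s_cycle[of 0] embedding_add[OF E(1) \<tau>] embedding_mult[OF E(1) \<tau>]
        subfield_intros[OF E(1)])
  also have "\<dots> = (sign_at g h * w \<delta> h + sign_at g (2 + h) * w \<delta> (2 + h)) *
      (sign_at g (1 + h) * w \<delta> (1 + h) + sign_at g (3 + h) * w \<delta> (3 + h))"
    using acts by (simp add: acts_def h_def)
  also have "sign_at g (2 + h) = sign_at g h" by (rule sign_at_parity) simp
  also have "sign_at g (3 + h) = sign_at g (1 + h)" by (rule sign_at_parity) simp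
  also have "(sign_at g h * w \<delta> h + sign_at g h * w \<delta> (2 + h)) *
      (sign_at g (1 + h) * w \<delta> (1 + h) + sign_at g (1 + h) * w \<delta> (3 + h)) =
      sign_at g h * sign_at g (h + 1) * s \<delta>"
    by (simp add: s_cycle[of h] algebra_simps)
  finally show ?thesis by (simp add: h_def)
qed

section \<open>The Galois group of the octic\<close>

text \<open>From s \<delta> one obtains z + \<delta>/z by division, and then the relation between x and z gives
  z - \<delta>/z. So the field generated by x and s \<delta> contains all roots.\<close>

lemma z_in_subfield:
  assumes \<delta>: "\<delta> = 1 \<or> \<delta> = -1" and F: "complex_subfield F" "x \<in> F" "s \<delta> \<in> F"
  shows "z \<in> F"
proof -
  note F_intros = subfield_intros[OF F(1)]
  have \<delta>F: "\<delta> \<in> F" using \<delta> F_intros(1) by auto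
  have "z + \<delta> / z = s \<delta> / (x + \<delta> / x)"
    using factors_nonzero[OF \<delta>] by (simp add: s_def)
  then have sum: "z + \<delta> / z \<in> F" using F \<delta>F by (simp add: F_intros)
  have "z\<^sup>2 + 1 / z\<^sup>2 = - of_rat a - (x\<^sup>2 + 1 / x\<^sup>2)"
    using trace_sum by (simp add: algebra_simps)
  then have trace: "z\<^sup>2 + 1 / z\<^sup>2 \<in> F" using F by (simp add: F_intros)
  have "z\<^sup>2 - 1 / z\<^sup>2 = c * ((x\<^sup>2 + 1 / x\<^sup>2) - (z\<^sup>2 + 1 / z\<^sup>2)) / (x\<^sup>2 - 1 / x\<^sup>2)"
    using relation squares_distinct(1) by (simp add: nonzero_eq_divide_eq mult.commute)
  then have diff: "z\<^sup>2 - 1 / z\<^sup>2 \<in> F" using F trace c by (simp add: F_intros)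
  have "z\<^sup>2 - 1 / z\<^sup>2 = (z - \<delta> / z) * (z + \<delta> / z)"
    using \<delta> nonzero by (auto simp: algebra_simps power2_eq_square)
  then have "z - \<delta> / z = (z\<^sup>2 - 1 / z\<^sup>2) / (z + \<delta> / z)"
    using factors_nonzero(2)[OF \<delta>] by simp
  then have "z - \<delta> / z \<in> F" using sum diff by (simp add: F_intros(7))
  from F_intros(7)[OF F_intros(2)[OF sum this] F_intros(1)[of 2]]
  have "((z + \<delta> / z) + (z - \<delta> / z)) / 2 \<in> F" by simp
  then show ?thesis by simp
qed

lemma splitting_field_in_subfield:
  assumes F: "complex_subfield F" "x \<in> F" "z \<in> F"
  shows "carrier (splitting_field f) \<subseteq> F"
  using F by (intro splitting_field_subset) (auto simp: croots_f subfield_intros(1,5,7)[OF F(1)])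

lemma x_z_splitting_field: "x \<in> carrier (splitting_field f)" "z \<in> carrier (splitting_field f)"
  using croots_subset_splitting_field[of f] by (auto simp: croots_f)

text \<open>Modulo f the polynomial p may be assumed to have degree less than 8; being constant at eight
  points, it is then constant.\<close>

lemma rational_if_constant_on_roots:
  assumes "\<And>y. y \<in> croots f \<Longrightarrow> ev p y = v"
  shows "v \<in> \<rat>"
proof -
  define q where "q = p mod f"
  have q: "ev q y = v" if "y \<in> croots f" for y
  proof -
    have "ev (f * (p div f) + q) y = ev p y" by (simp add: q_def)
    then show ?thesis using assms that by (simp add: croots_ev)
  qed
  define P where "P = map_poly of_rat q - [:v:]"
  have "degree q < 8"
    using degree_mod_less'[of f p] degree_f f_nonzero unfolding q_def by (cases "p mod f = 0") auto
  then have "degree P < 8"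
    unfolding P_def by (intro degree_diff_less) (auto simp: degree_map_poly)
  have "P = 0"
  proof (rule ccontr)
    assume "P \<noteq> 0"
    have "card (croots f) \<le> card {y. poly P y = 0}"
      using q poly_roots_finite[OF \<open>P \<noteq> 0\<close>] by (intro card_mono) (auto simp: P_def)
    also have "\<dots> \<le> degree P" using \<open>P \<noteq> 0\<close> by (rule card_poly_roots_bound)
    finally show False using \<open>degree P < 8\<close> card_croots by simp
  qed
  then have "coeff (map_poly of_rat q) 0 = coeff [:v:] 0" by (simp add: P_def)
  then have "v = of_rat (coeff q 0)" by (simp add: coeff_map_poly)
  then show ?thesis by simp
qed

text \<open>Suppose that all roots lie in the field of degree 8 generated by x, so that an embedding is
  determined by the image of x. Let \<kappa> map x to -x and \<gamma> map x to z. Both are given by elements of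
  the group of order 16, so \<kappa> z = \<pm> z and \<gamma> z = \<pm> 1/x; the second sign is taken as \<delta>. If \<kappa> fixed z,
  then \<kappa>\<gamma> and \<gamma> would agree at x but not at z. Hence \<kappa> negates every root, and both \<kappa> and \<gamma> fix
  s \<delta>. Since \<kappa> and \<gamma> reach all eight roots from x, the element s \<delta> is rational.\<close>

lemma rational_s:
  assumes z: "z \<in> adjoin x"
  obtains \<delta> where "\<delta> = 1 \<or> \<delta> = -1" "s \<delta> \<in> \<rat>"
proof -
  define E where "E = adjoin x"
  have E: "complex_subfield E"
    unfolding E_def by (rule complex_subfield_adjoin[OF irreducible root_x])
  note E_intros = subfield_intros[OF E]
  have xz: "x \<in> E" "z \<in> E" using z adjoin_self by (simp_all add: E_def)
  obtain q where q: "ev q x = z" using z by (auto simp: adjoin_def)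
  have "ev f (- x) = 0" using croots_f by (simp add: croots_ev set_eq_iff)
  then obtain \<kappa> where \<kappa>: "embedding E \<kappa>" and \<kappa>_ev: "\<And>p. \<kappa> (ev p x) = ev p (- x)"
    using embedding_adjoin[OF irreducible root_x] unfolding E_def by blast
  have "ev f z = 0" using croots_f by (simp add: croots_ev set_eq_iff)
  then obtain \<gamma> where \<gamma>: "embedding E \<gamma>" and \<gamma>_ev: "\<And>p. \<gamma> (ev p x) = ev p z"
    using embedding_adjoin[OF irreducible root_x] unfolding E_def by blast
  have \<kappa>x: "\<kappa> x = - x" and \<gamma>x: "\<gamma> x = z"
    using \<kappa>_ev[of "[:0, 1:]"] \<gamma>_ev[of "[:0, 1:]"] by simp_all
  note \<kappa>_simps = embedding_add[OF E \<kappa>] embedding_mult[OF E \<kappa>] embedding_divide[OF E \<kappa>]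
    embedding_Rats[OF E \<kappa>] embedding_uminus[OF E \<kappa>]
  note \<gamma>_simps = embedding_add[OF E \<gamma>] embedding_mult[OF E \<gamma>] embedding_divide[OF E \<gamma>]
    embedding_Rats[OF E \<gamma>] embedding_uminus[OF E \<gamma>]
  have \<kappa>z: "\<kappa> z = z \<or> \<kappa> z = - z"
  proof -
    obtain g where g: "g \<in> carrier C2sq_C4" "acts 1 g \<kappa>"
      using embedding_acts[OF _ E xz \<kappa>] by blast
    have "-1 * w 1 0 = sign_at g (snd g) * w 1 (snd g)"
      using g(2)[unfolded acts_def, rule_format, of 0] \<kappa>x by (simp add: w_def[of 1 0])
    from arg_cong[OF this, of power2] have "(w 1 (snd g))\<^sup>2 = (w 1 0)\<^sup>2"
      using sign_at_cases[of g "snd g"] by auto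
    then have "snd g mod 4 = 0 mod 4" by (intro w_squares_inj) simp_all
    then have "snd g = 0" using g(1) by (auto simp: carrier_C2sq_C4)
    then have "\<kappa> (w 1 1) = sign_at g 1 * w 1 1" using g(2) by (simp add: acts_def)
    then show ?thesis using sign_at_cases[of g 1] by (auto simp: w_def)
  qed
  have "\<gamma> z = 1 / x \<or> \<gamma> z = -1 / x"
  proof -
    obtain g where g: "g \<in> carrier C2sq_C4" "acts 1 g \<gamma>"
      using embedding_acts[OF _ E xz \<gamma>] by blast
    have "w 1 1 = sign_at g (snd g) * w 1 (snd g)"
      using g(2)[unfolded acts_def, rule_format, of 0] \<gamma>x by (simp add: w_def[of 1 0] w_def[of 1 1])
    from arg_cong[OF this, of power2] have "(w 1 (snd g))\<^sup>2 = (w 1 1)\<^sup>2"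
      using sign_at_cases[of g "snd g"] by auto
    then have "snd g mod 4 = 1 mod 4" by (intro w_squares_inj) simp_all
    then have "snd g = 1" using g(1) by (auto simp: carrier_C2sq_C4)
    then have "\<gamma> (w 1 1) = sign_at g 2 * w 1 2" using g(2) by (simp add: acts_def)
    then show ?thesis using sign_at_cases[of g 2] by (auto simp: w_def)
  qed
  then obtain \<delta> where \<delta>: "\<delta> = 1 \<or> \<delta> = -1" and \<gamma>z: "\<gamma> z = \<delta> / x" by blast
  have \<delta>_rat: "\<delta> \<in> \<rat>" using \<delta> by auto
  \<comment> \<open>The polynomial q expresses z by x; applying \<gamma> and then \<kappa> to this expression is the
      composition argument.\<close>
  have "\<kappa> z \<noteq> z"
  proof
    assume "\<kappa> z = z"
    have "ev q z = \<delta> / x" using \<gamma>_ev[of q] \<gamma>z q by simp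
    then have "\<kappa> (\<delta> / x) = \<delta> / x"
      using embedding_ev[OF E \<kappa> xz(2), of q] \<open>\<kappa> z = z\<close> by simp
    moreover have "\<kappa> (\<delta> / x) = - (\<delta> / x)"
      using xz \<delta>_rat by (simp add: \<kappa>_simps E_intros(1) \<kappa>x)
    ultimately show False using \<delta> nonzero by auto
  qed
  with \<kappa>z have \<kappa>z: "\<kappa> z = - z" by blast
  have s_E: "s \<delta> \<in> E"
    using xz \<delta>_rat by (simp add: s_def E_intros)
  have \<kappa>s: "\<kappa> (s \<delta>) = s \<delta>"
    using xz \<delta>_rat by (simp add: s_def \<kappa>_simps E_intros \<kappa>x \<kappa>z algebra_simps)
  have \<gamma>s: "\<gamma> (s \<delta>) = s \<delta>"
    using xz \<delta> \<delta>_rat nonzero by (auto simp: s_def \<gamma>_simps E_intros \<gamma>x \<gamma>z algebra_simps)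
  obtain p where p: "ev p x = s \<delta>" using s_E by (auto simp: E_def adjoin_def)
  have \<gamma>p: "ev p (\<gamma> y) = s \<delta>" if "y \<in> E" "ev p y = s \<delta>" for y
    using embedding_ev[OF E \<gamma> that(1), of p] that(2) \<gamma>s by simp
  have \<kappa>p: "ev p (\<kappa> y) = s \<delta>" if "y \<in> E" "ev p y = s \<delta>" for y
    using embedding_ev[OF E \<kappa> that(1), of p] that(2) \<kappa>s by simp
  have inv_E: "\<delta> / x \<in> E" "\<delta> / z \<in> E" using xz \<delta>_rat by (simp_all add: E_intros)
  have p1: "ev p z = s \<delta>" using \<gamma>p[OF xz(1) p] \<gamma>x by simp
  have p2: "ev p (\<delta> / x) = s \<delta>" using \<gamma>p[OF xz(2) p1] \<gamma>z by simp
  have "\<gamma> (\<delta> / x) = \<delta> / z" using xz \<delta>_rat by (simp add: \<gamma>_simps E_intros(1) \<gamma>x)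
  then have p3: "ev p (\<delta> / z) = s \<delta>" using \<gamma>p[OF inv_E(1) p2] by simp
  have pos: "ev p y = s \<delta>" "y \<in> E" "\<kappa> y = - y" if "y \<in> range (w \<delta>)" for y
    using that p p1 p2 p3 xz inv_E \<delta>_rat unfolding range_w
    by (auto simp: \<kappa>x \<kappa>z \<kappa>_simps E_intros(1))
  have "ev p y = s \<delta>" if "y \<in> croots f" for y
    using that \<kappa>p pos unfolding croots_w[OF \<delta>] by fastforce
  then have "s \<delta> \<in> \<rat>" by (rule rational_if_constant_on_roots)
  with \<delta> show ?thesis by (rule that)
qed

definition realized :: "complex \<Rightarrow> (int \<times> int) \<times> int \<Rightarrow> bool" where
  "realized \<delta> g \<longleftrightarrow> (\<exists>\<tau>. embedding (carrier (splitting_field f)) \<tau> \<and> acts \<delta> g \<tau>)"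

text \<open>The images of x and of s \<delta> determine the group element: the image of x gives h and the sign at
  h, and the sign by which s \<delta> is multiplied then gives the sign at h + 1.\<close>

lemma realizedI:
  assumes \<delta>: "\<delta> = 1 \<or> \<delta> = -1" and s: "s \<delta> \<noteq> 0" and g: "g \<in> carrier C2sq_C4"
    and \<tau>: "embedding (carrier (splitting_field f)) \<tau>"
    and \<tau>x: "\<tau> x = sign_at g (snd g) * w \<delta> (snd g)"
    and \<tau>s: "\<tau> (s \<delta>) = sign_at g (snd g) * sign_at g (snd g + 1) * s \<delta>"
  shows "realized \<delta> g"
proof -
  note K = complex_subfield_splitting_field[of f] x_z_splitting_field
  obtain g' where g': "g' \<in> carrier C2sq_C4" and acts: "acts \<delta> g' \<tau>"
    using embedding_acts[OF \<delta> K \<tau>] .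
  have "\<tau> x = sign_at g' (snd g') * w \<delta> (snd g')"
    using acts[unfolded acts_def, rule_format, of 0] by (simp add: w_def[of \<delta> 0])
  then have eq: "sign_at g' (snd g') * w \<delta> (snd g') = sign_at g (snd g) * w \<delta> (snd g)"
    using \<tau>x by simp
  then have "(sign_at g' (snd g') * w \<delta> (snd g'))\<^sup>2 = (sign_at g (snd g) * w \<delta> (snd g))\<^sup>2"
    by simp
  then have "(w \<delta> (snd g'))\<^sup>2 = (w \<delta> (snd g))\<^sup>2"
    using sign_at_cases[of g' "snd g'"] sign_at_cases[of g "snd g"] by auto
  then have "snd g' mod 4 = snd g mod 4" by (rule w_squares_inj[OF \<delta>])
  moreover have "snd g \<in> {0..<4}" "snd g' \<in> {0..<4}"
    using g g' unfolding carrier_C2sq_C4 by auto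
  ultimately have snd: "snd g' = snd g" by simp
  then have sign: "sign_at g' (snd g) = sign_at g (snd g)"
    using eq w_nonzero[OF \<delta>] by simp
  have "sign_at g' (snd g) * sign_at g' (snd g + 1) = sign_at g (snd g) * sign_at g (snd g + 1)"
    using acts_s[OF \<delta> K \<tau> acts] \<tau>s s snd by simp
  then have "sign_at g' (snd g + 1) = sign_at g (snd g + 1)"
    using sign sign_at_cases[of g "snd g"] by auto
  then have "g' = g" using sign_at_inject[OF g' g snd, of "snd g"] sign by simp
  then show ?thesis using acts \<tau> by (auto simp: realized_def)
qed

text \<open>A permutation of the indices comes from an automorphism exactly if it is the one by which some
  realized group element moves the roots. So the action on the roots can be computed in the
  abstract group, without composing automorphisms.\<close>

lemma galois_perms_moves:
  assumes \<delta>: "\<delta> = 1 \<or> \<delta> = -1" and r: "bij_betw r {1..8} (croots f)"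
  shows "p \<in> galois_perms f r \<longleftrightarrow>
      (\<exists>g\<in>carrier C2sq_C4. realized \<delta> g \<and> signed_cycle.moves (w \<delta>) r g p)"
    and "realized \<delta> g \<Longrightarrow> \<exists>p. signed_cycle.moves (w \<delta>) r g p"
proof -
  interpret signed_cycle "w \<delta>" r using signed_cycle_w[OF \<delta> r] .
  define K where "K = carrier (splitting_field f)"
  have K: "complex_subfield K" "x \<in> K" "z \<in> K"
    using complex_subfield_splitting_field x_z_splitting_field by (simp_all add: K_def)
  have roots: "croots f \<subseteq> K" using croots_subset_splitting_field by (simp add: K_def)
  have wK: "w \<delta> k \<in> K" for k
    using roots signed_croots[OF \<delta>, of 1 k] by auto
  have image: "\<tau> (e * w \<delta> k) = e * sign_at g (k + snd g) * w \<delta> (k + snd g)"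
    if "embedding K \<tau>" "acts \<delta> g \<tau>" "e = 1 \<or> e = -1" for \<tau> g e k
  proof -
    have "e \<in> \<rat>" using that(3) by auto
    then have "\<tau> (e * w \<delta> k) = e * \<tau> (w \<delta> k)"
      using wK subfield_Rats[OF K(1)]
      by (simp add: embedding_mult[OF K(1) that(1)] embedding_Rats[OF K(1) that(1)])
    then show ?thesis using that(2) by (simp add: acts_def)
  qed
  have moves: "moves g p \<longleftrightarrow> p permutes {1..8} \<and> (\<forall>i\<in>{1..8}. \<tau> (r i) = r (p i))"
    if "embedding K \<tau>" "acts \<delta> g \<tau>" for \<tau> g p
  proof -
    have "\<tau> (r i) = r (p i)" if p: "moves g p" and i: "i \<in> {1..8}" for i
    proof -
      obtain e k where "e = 1 \<or> e = -1" "r i = e * w \<delta> k" using enum_cases[OF i] .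
      then show ?thesis
        using movesD[OF p i] image[OF \<open>embedding K \<tau>\<close> \<open>acts \<delta> g \<tau>\<close>] by simp
    qed
    moreover have "moves g p" if "p permutes {1..8}" "\<forall>i\<in>{1..8}. \<tau> (r i) = r (p i)"
      unfolding moves_def
    proof (intro conjI ballI allI impI that(1))
      fix i k and e :: complex assume i: "i \<in> {1..8}" and e: "e = 1 \<or> e = -1" "r i = e * w \<delta> k"
      have "r (p i) = \<tau> (r i)" using that(2) i by simp
      then show "r (p i) = e * sign_at g (k + snd g) * w \<delta> (k + snd g)"
        using image[OF \<open>embedding K \<tau>\<close> \<open>acts \<delta> g \<tau>\<close> e(1)] e(2) by simp
    qed
    ultimately show ?thesis using moves_permutes by blast
  qed
  have galois: "p \<in> galois_perms f r \<longleftrightarrow> p permutes {1..8} \<and>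
      (\<exists>\<tau>. embedding K \<tau> \<and> (\<forall>i\<in>{1..8}. \<tau> (r i) = r (p i)))"
    using galois_perms_embedding[OF f_nonzero, of r] r by (simp add: degree_f K_def)
  show "p \<in> galois_perms f r \<longleftrightarrow> (\<exists>g\<in>carrier C2sq_C4. realized \<delta> g \<and> moves g p)"
  proof
    assume "p \<in> galois_perms f r"
    then obtain \<tau> where p: "p permutes {1..8}" and \<tau>: "embedding K \<tau>"
      "\<forall>i\<in>{1..8}. \<tau> (r i) = r (p i)" using galois by blast
    obtain g where g: "g \<in> carrier C2sq_C4" "acts \<delta> g \<tau>" using embedding_acts[OF \<delta> K \<tau>(1)] .
    then have "realized \<delta> g" using \<tau>(1) by (auto simp: realized_def K_def)
    then show "\<exists>g\<in>carrier C2sq_C4. realized \<delta> g \<and> moves g p"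
      using g moves[OF \<tau>(1) g(2)] p \<tau>(2) by blast
  next
    assume "\<exists>g\<in>carrier C2sq_C4. realized \<delta> g \<and> moves g p"
    then obtain g \<tau> where "embedding K \<tau>" "acts \<delta> g \<tau>" "moves g p"
      unfolding realized_def K_def by blast
    then show "p \<in> galois_perms f r" using moves galois by blast
  qed
  show "\<exists>p. moves g p" if "realized \<delta> g"
  proof -
    obtain \<tau> where \<tau>: "embedding K \<tau>" "acts \<delta> g \<tau>"
      using \<open>realized \<delta> g\<close> unfolding realized_def K_def by blast
    have bij: "bij_betw \<tau> (croots f) (croots f)"
      by (rule embedding_permutes_roots[OF f_nonzero K(1) roots \<tau>(1)])
    define p where "p i = (if i \<in> {1..8} then inv_into {1..8} r (\<tau> (r i)) else i)" for i
    have "bij_betw (inv_into {1..8} r \<circ> (\<tau> \<circ> r)) {1..8} {1..8}"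
      using bij_betw_trans[OF bij_betw_trans[OF r bij] bij_betw_inv_into[OF r]] .
    moreover have "bij_betw p {1..8} {1..8} \<longleftrightarrow> bij_betw (inv_into {1..8} r \<circ> (\<tau> \<circ> r)) {1..8} {1..8}"
      by (rule bij_betw_cong) (simp add: p_def)
    ultimately have "p permutes {1..8}" by (intro bij_imp_permutes) (auto simp: p_def)
    moreover have "\<tau> (r i) = r (p i)" if "i \<in> {1..8}" for i
    proof -
      have "\<tau> (r i) \<in> r ` {1..8}" using that r bij unfolding bij_betw_def by blast
      then show ?thesis using that by (simp add: p_def f_inv_into_f)
    qed
    ultimately show ?thesis using moves[OF \<tau>] by blast
  qed
qed

lemma galois_type_of_realized:
  assumes \<delta>: "\<delta> = 1 \<or> \<delta> = -1"
    and S: "group S" "\<iota> \<in> hom S C2sq_C4" "inj_on \<iota> (carrier S)"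
    and diagonal: "\<And>e h. e \<in> {0..<2} \<Longrightarrow> h \<in> {0..<4} \<Longrightarrow> ((e, e), h) \<in> \<iota> ` carrier S"
    and realized: "\<And>g. g \<in> carrier C2sq_C4 \<Longrightarrow> realized \<delta> g \<longleftrightarrow> g \<in> \<iota> ` carrier S"
  shows "galois_type f {H \<in> transitive_subgroups 8. (sym_group 8)\<lparr>carrier := H\<rparr> \<cong> S}"
proof -
  obtain r :: "nat \<Rightarrow> complex" where r: "bij_betw r {1..8} (croots f)"
    using ex_bij_betw_nat_finite_1[OF finite_croots[OF f_nonzero]] unfolding card_croots by blast
  interpret signed_cycle "w \<delta>" r using signed_cycle_w[OF \<delta> r] .
  have \<iota>: "\<iota> ` carrier S \<subseteq> carrier C2sq_C4"
    using hom_in_carrier[OF S(2)] by blast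
  have mem: "p \<in> galois_perms f r \<longleftrightarrow> (\<exists>g\<in>carrier S. moves (\<iota> g) p)" for p
    unfolding galois_perms_moves(1)[OF \<delta> r] using realized \<iota> by blast
  have ex: "\<exists>p. moves (\<iota> g) p" if "g \<in> carrier S" for g
    using that realized \<iota> by (intro galois_perms_moves(2)[OF \<delta> r]) blast
  show ?thesis
    unfolding galois_type_def degree_f
    using moves_group[OF S diagonal mem ex] r by blast
qed

text \<open>If s \<delta> is rational, every automorphism fixes it, so m = n. The elements with m = n form a direct
  product of cyclic groups of orders 4 and 2; each of them is realized, because the
  splitting field is generated by x alone and x can be sent to any root.\<close>

lemma galois_type_8T2:
  assumes \<delta>: "\<delta> = 1 \<or> \<delta> = -1" and s: "s \<delta> \<in> \<rat>" "s \<delta> \<noteq> 0"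
  shows "galois_type f class_8T2"
  unfolding class_8T2_def
proof (rule galois_type_of_realized[OF \<delta> _ hom_diagonal])
  show "group (integer_mod_group 4 \<times>\<times> integer_mod_group 2)"
    by (intro DirProd_group group_integer_mod_group)
  show "inj_on (\<lambda>(h, e). ((e, e), h)) (carrier (integer_mod_group 4 \<times>\<times> integer_mod_group 2))"
    by (auto simp: inj_on_def)
  have image: "(\<lambda>(h, e). ((e, e), h)) ` carrier (integer_mod_group 4 \<times>\<times> integer_mod_group 2) =
      {((e, e), h) | e h. e \<in> {0..<2} \<and> h \<in> {0..<4}}"
    by (auto simp: DirProd_def carrier_integer_mod_group image_iff)
  show "((e, e), h) \<in> (\<lambda>(h, e). ((e, e), h)) ` carrier (integer_mod_group 4 \<times>\<times> integer_mod_group 2)"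
    if "e \<in> {0..<2}" "h \<in> {0..<4}" for e h
    unfolding image using that by blast
  define E where "E = adjoin x"
  have E: "complex_subfield E" "x \<in> E"
    unfolding E_def using adjoin_self by (auto intro: complex_subfield_adjoin[OF irreducible root_x])
  have "z \<in> E" by (rule z_in_subfield[OF \<delta> E]) (rule subfield_Rats[OF E(1) s(1)])
  then have K_E: "carrier (splitting_field f) \<subseteq> E"
    by (rule splitting_field_in_subfield[OF E])
  note K = complex_subfield_splitting_field[of f] x_z_splitting_field
  show "realized \<delta> g \<longleftrightarrow>
      g \<in> (\<lambda>(h, e). ((e, e), h)) ` carrier (integer_mod_group 4 \<times>\<times> integer_mod_group 2)"
    if g: "g \<in> carrier C2sq_C4" for g
    unfolding image
  proof
    assume "realized \<delta> g"
    then obtain \<tau> where \<tau>: "embedding (carrier (splitting_field f)) \<tau>" "acts \<delta> g \<tau>"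
      by (auto simp: realized_def)
    have sign: "sign_at g (snd g) * sign_at g (snd g + 1) = 1"
      using acts_s[OF \<delta> K \<tau>] embedding_Rats[OF K(1) \<tau>(1) s(1)] s(2) by simp
    obtain m n h where mnh: "g = ((m, n), h)" by (metis surj_pair)
    have "m = 0 \<or> m = 1" "n = 0 \<or> n = 1" using g by (auto simp: carrier_C2sq_C4 mnh)
    then have "m = n" using sign by (cases "even h") (auto simp: sign_at_def mnh)
    then show "g \<in> {((e, e), h) | e h. e \<in> {0..<2} \<and> h \<in> {0..<4}}"
      using g by (auto simp: carrier_C2sq_C4 mnh)
  next
    assume "g \<in> {((e, e), h) | e h. e \<in> {0..<2} \<and> h \<in> {0..<4}}"
    then have "sign_at g (snd g + 1) = sign_at g (snd g)" by (auto simp: sign_at_def)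
    then have sign: "sign_at g (snd g) * sign_at g (snd g + 1) = 1"
      using sign_at_cases[of g "snd g"] by auto
    let ?y = "sign_at g (snd g) * w \<delta> (snd g)"
    have "?y \<in> croots f" by (rule signed_croots[OF \<delta> sign_at_cases])
    then obtain \<sigma> where \<sigma>: "embedding E \<sigma>" "\<And>p. \<sigma> (ev p x) = ev p ?y"
      using embedding_adjoin[OF irreducible root_x, of ?y] by (auto simp: croots_ev E_def)
    have \<sigma>x: "\<sigma> x = ?y" using \<sigma>(2)[of "[:0, 1:]"] by simp
    have \<sigma>K: "embedding (carrier (splitting_field f)) \<sigma>"
      using \<sigma>(1) K_E by (rule embedding_mono)
    show "realized \<delta> g"
      using realizedI[OF \<delta> s(2) g \<sigma>K \<sigma>x] embedding_Rats[OF K(1) \<sigma>K s(1)] sign by simp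
  qed
qed

text \<open>If s 1 does not lie in the field generated by x, the image of x and the sign of the image of
  s 1 can be prescribed independently, which realizes all 16 elements.\<close>

lemma galois_type_8T10:
  assumes s: "s 1 \<notin> adjoin x"
  shows "galois_type f class_8T10"
  unfolding class_8T10_def
proof (rule galois_type_of_realized[where \<delta> = 1 and \<iota> = "\<lambda>g. g"])
  show "group C2sq_C4" by (rule group_C2sq_C4)
  show "(\<lambda>g. g) \<in> hom C2sq_C4 C2sq_C4" by (simp add: hom_def Pi_def monoid.m_closed[OF group.is_monoid[OF group_C2sq_C4]])
  show "((e, e), h) \<in> (\<lambda>g. g) ` carrier C2sq_C4" if "e \<in> {0..<2}" "h \<in> {0..<4}" for e h
    using that by (simp add: carrier_C2sq_C4)
  define E where "E = adjoin x"
  have E: "complex_subfield E" "x \<in> E"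
    unfolding E_def using adjoin_self by (auto intro: complex_subfield_adjoin[OF irreducible root_x])
  have "(s 1)\<^sup>2 = of_rat (b + 2 - 2 * a)"
    using s_squared[of 1] by (simp add: of_rat_add of_rat_diff of_rat_mult)
  then have s2: "(s 1)\<^sup>2 \<in> \<rat>" by simp
  have s_E: "s 1 \<notin> E" using s by (simp add: E_def)
  have s2_E: "(s 1)\<^sup>2 \<in> E" by (rule subfield_Rats[OF E(1) s2])
  have s0: "s 1 \<noteq> 0" using factors_nonzero[of 1] by (simp add: s_def)
  define F where "F = adjoin_root E (s 1)"
  have F: "complex_subfield F" "x \<in> F" "s 1 \<in> F"
    unfolding F_def using adjoin_root_base[OF E(1) E(2)] adjoin_root_self[OF E(1)]
      complex_subfield_adjoin_root[OF E(1) s2_E] by blast+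
  have "z \<in> F" by (rule z_in_subfield[OF _ F]) simp
  then have K_F: "carrier (splitting_field f) \<subseteq> F"
    by (rule splitting_field_in_subfield[OF F(1,2)])
  show "realized 1 g \<longleftrightarrow> g \<in> (\<lambda>g. g) ` carrier C2sq_C4" if g: "g \<in> carrier C2sq_C4" for g
  proof -
    let ?y = "sign_at g (snd g) * w 1 (snd g)"
    let ?t = "sign_at g (snd g) * sign_at g (snd g + 1) * s 1"
    have "?y \<in> croots f" by (rule signed_croots[OF _ sign_at_cases]) simp
    then obtain \<sigma> where \<sigma>: "embedding E \<sigma>" "\<And>p. \<sigma> (ev p x) = ev p ?y"
      using embedding_adjoin[OF irreducible root_x, of ?y] by (auto simp: croots_ev E_def)
    have \<sigma>x: "\<sigma> x = ?y" using \<sigma>(2)[of "[:0, 1:]"] by simp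
    have "?t\<^sup>2 = (s 1)\<^sup>2"
      using sign_at_cases[of g "snd g"] sign_at_cases[of g "snd g + 1"] by auto
    then have t: "?t\<^sup>2 = \<sigma> ((s 1)\<^sup>2)" using embedding_Rats[OF E(1) \<sigma>(1) s2] by simp
    obtain \<tau> where \<tau>: "embedding F \<tau>" "\<And>u. u \<in> E \<Longrightarrow> \<tau> u = \<sigma> u" "\<tau> (s 1) = ?t"
      using embedding_adjoin_root[OF E(1) \<sigma>(1) s_E s2_E t] unfolding F_def by blast
    have "realized 1 g"
    proof (rule realizedI[OF _ s0 g])
      show "embedding (carrier (splitting_field f)) \<tau>" using \<tau>(1) K_F by (rule embedding_mono)
      show "\<tau> x = ?y" using \<tau>(2)[OF E(2)] \<sigma>x by simp
      show "\<tau> (s 1) = ?t" by (rule \<tau>(3))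
    qed simp
    then show ?thesis using g by simp
  qed
qed simp_all

end

theorem theorem4p8:
  fixes a b :: rat and f :: "rat poly"
  assumes "a \<noteq> 0"
    and "f = [:1, 0, a, 0, b, 0, a, 0, 1:]"
    and "Factorial_Ring.irreducible f"
    and "(b + 2)\<^sup>2 - 4 * a\<^sup>2 \<notin> rat_squares"
    and "(a\<^sup>2 - 4 * b + 8) * ((b + 2)\<^sup>2 - 4 * a\<^sup>2) \<in> rat_squares"
  shows "(b + 2 - 2 * a \<in> rat_squares \<or> b + 2 + 2 * a \<in> rat_squares \<longrightarrow>
            galois_type f class_8T2) \<and>
         (\<not> (b + 2 - 2 * a \<in> rat_squares \<or> b + 2 + 2 * a \<in> rat_squares) \<longrightarrow>
            galois_type f class_8T10)"
proof -
  have "(b + 2)\<^sup>2 - 4 * a\<^sup>2 \<noteq> 0"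
  proof
    assume "(b + 2)\<^sup>2 - 4 * a\<^sup>2 = 0"
    then have "(b + 2)\<^sup>2 - 4 * a\<^sup>2 = 0\<^sup>2" by simp
    then show False using assms(4) unfolding rat_squares_def by blast
  qed
  moreover obtain k where "(a\<^sup>2 - 4 * b + 8) * ((b + 2)\<^sup>2 - 4 * a\<^sup>2) = k\<^sup>2"
    using assms(5) unfolding rat_squares_def by blast
  ultimately obtain x z c where "octic a b f x z c"
    using exists_octic[OF assms(2,3)] by blast
  then interpret octic a b f x z c .
  have s_value: "(s \<delta>)\<^sup>2 = of_rat (if \<delta> = 1 then b + 2 - 2 * a else b + 2 + 2 * a)"
    if "\<delta> = 1 \<or> \<delta> = -1" for \<delta>
    using s_squared[OF that] that by (auto simp: of_rat_add of_rat_diff of_rat_mult)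
  have nonzero: "s \<delta> \<noteq> 0" if "\<delta> = 1 \<or> \<delta> = -1" for \<delta>
    using factors_nonzero[OF that] by (simp add: s_def)
  have iff: "s \<delta> \<in> \<rat> \<longleftrightarrow> (if \<delta> = 1 then b + 2 - 2 * a else b + 2 + 2 * a) \<in> rat_squares"
    (is "_ \<longleftrightarrow> ?v \<in> _") if "\<delta> = 1 \<or> \<delta> = -1" for \<delta>
  proof
    assume "s \<delta> \<in> \<rat>"
    then obtain q where "s \<delta> = of_rat q" by (auto elim: Rats_cases)
    then have "of_rat (q\<^sup>2) = (of_rat ?v :: complex)" using s_value[OF that] by (simp add: of_rat_power)
    then have "?v = q\<^sup>2" by (simp only: of_rat_eq_iff)
    then show "?v \<in> rat_squares" unfolding rat_squares_def by blast
  next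
    assume "?v \<in> rat_squares"
    then obtain q where "?v = q\<^sup>2" unfolding rat_squares_def by blast
    then have "(s \<delta>)\<^sup>2 = (of_rat q)\<^sup>2" using s_value[OF that] by (simp only: of_rat_power)
    then have "s \<delta> = of_rat q \<or> s \<delta> = - of_rat q" by (simp only: power2_eq_iff)
    then show "s \<delta> \<in> \<rat>" by (auto simp: Rats_minus_iff)
  qed
  have "galois_type f class_8T2" if "b + 2 - 2 * a \<in> rat_squares \<or> b + 2 + 2 * a \<in> rat_squares"
    using that
  proof
    assume "b + 2 - 2 * a \<in> rat_squares"
    then show ?thesis using galois_type_8T2[of 1] iff[of 1] nonzero[of 1] by simp
  next
    assume "b + 2 + 2 * a \<in> rat_squares"
    then show ?thesis using galois_type_8T2[of "-1"] iff[of "-1"] nonzero[of "-1"] by simp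
  qed
  moreover have "galois_type f class_8T10"
    if "\<not> (b + 2 - 2 * a \<in> rat_squares \<or> b + 2 + 2 * a \<in> rat_squares)"
  proof (rule galois_type_8T10, rule notI)
    assume s: "s 1 \<in> adjoin x"
    have "z \<in> adjoin x"
      by (rule z_in_subfield[OF _ complex_subfield_adjoin[OF irreducible root_x] adjoin_self s]) simp
    then obtain \<delta> where "\<delta> = 1 \<or> \<delta> = -1" "s \<delta> \<in> \<rat>" by (rule rational_s)
    then show False using iff[of \<delta>] that by (auto split: if_splits)
  qed
  ultimately show ?thesis by blast
qed

end
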